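(* Let $\mu_1,\ldots,\mu_n$ be pairwise different nonzero complex numbers and let $z_1,\ldots,z_n\in\mathbb{C}^n$ be nonzero linearly independent vectors. Denote $$\widetilde{\lambda}_k^m=\ln|\mu_m|+\mathrm{i}(\operatorname{Arg}\mu_m+2\pi k),\qquad m=1,\ldots,n,\ k\in\mathbb{Z}.$$ Let $\{\lambda_k^m\}_{k\in\mathbb{Z},\,m=1,\ldots,n}$ be a sequence of pairwise different complex numbers such that $$\sum_{k\in\mathbb{Z}}|\lambda_k^m-\widetilde{\lambda}_k^m|^2<\infty,\qquad m=1,\ldots,n,$$ indexed so that if $\lambda_{k_0}^{m_0}=\widetilde{\lambda}_k^m$ for some indices, then $m_0=m$ and $k_0=k$. Then for any sequence of vectors $\{\widehat d_k^m\}_{k\in\mathbb{Z},\,m=1,\ldots,n}\subset\mathbb{C}^n$ satisfying $$\sum_{k\in\mathbb{Z}}\|\widehat d_k^m-z_m\|^2<\infty,\qquad m=1,\ldots,n,$$ and for any $\varepsilon>0$, there is a sequence $\{d_k^m\}_{k\in\mathbb{Z},\,m=1,\ldots,n}\subset\mathbb{C}^n$ with $$\sum_{k\in\mathbb{Z}}\|d_k^m-\widehat d_k^m\|^2<\varepsilon,\qquad m=1,\ldots,n,$$ such that, for some choice of matrices $A_{-1},A_2(\theta),A_3(\theta)$ satisfying $\int_{-1}^0A_3(\theta)\,\mathrm{d}\theta=0$, the characteristic matrix $\Delta(\lambda)$ of the corresponding neutral type system satisfies: (i) $\det\Delta(\lambda_k^m)=0$ for all $k\in\mathbb{Z}$,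 $m=1,\ldots,n$; (ii) the vectors $d_k^m$ are degenerating vectors for $\Delta(\lambda_k^m)$, in the sense that $(d_k^m)^*\Delta(\lambda_k^m)=0$ for all $k\in\mathbb{Z}$, $m=1,\ldots,n$. Moreover, $\{d_k^m\}$ may be chosen in such a way that, for some $N\in\mathbb{N}$, $d_k^m=\widehat d_k^m$ for all $|k|>N$ (and all $m=1,\ldots,n$).
   Context: The neutral type system is $$\dot z(t)=A_{-1}\dot z(t-1)+\int_{-1}^0A_2(\theta)\dot z(t+\theta)\,\mathrm{d}\theta+\int_{-1}^0A_3(\theta)z(t+\theta)\,\mathrm{d}\theta,$$ where $A_{-1}$ is a constant complex $n\times n$ matrix and $A_2(\cdot),A_3(\cdot)$ are $n\times n$ matrices whose (complex-valued) entries belong to $L_2[-1,0]$. Its characteristic matrix is $$\Delta(\lambda)=\lambda I-\lambda \mathrm{e}^{-\lambda}A_{-1}-\int_{-1}^0\lambda \mathrm{e}^{\lambda\theta}A_2(\theta)\,\mathrm{d}\theta-\int_{-1}^0\mathrm{e}^{\lambda\theta}A_3(\theta)\,\mathrm{d}\theta,\qquad\lambda\in\mathbb{C}.$$ Here $v^*$ denotes the conjugate transpose of a vector $v$, and $\operatorname{Arg}$ the principal argument. *)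

theory Defs
  imports "HOL-Analysis.Analysis"
begin

text \<open>Matrix functions on \<open>[-1,0]\<close> all of whose entries belong to the Lebesgue space
  \<open>L\<^sub>2[-1,0]\<close> of complex-valued functions.\<close>

definition L2_entries :: "(real \<Rightarrow> complex^'n^'n) \<Rightarrow> bool" where
  "L2_entries A \<longleftrightarrow> (\<forall>i j.
     (\<lambda>\<theta>. A \<theta> $ i $ j) \<in> borel_measurable (lebesgue_on {-1..0}) \<and>
     integrable (lebesgue_on {-1..0}) (\<lambda>\<theta>. (cmod (A \<theta> $ i $ j))\<^sup>2))"

definition matrix_integral :: "(real \<Rightarrow> complex^'n^'n) \<Rightarrow> complex^'n^'n" where
  "matrix_integral A = (\<chi> i j. LINT \<theta>|lebesgue_on {-1..0}. A \<theta> $ i $ j)"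

text \<open>The characteristic matrix of the neutral type system
  \<open>z'(t) = A1 z'(t - 1) + \<integral> A2(\<theta>) z'(t + \<theta>) d\<theta> + \<integral> A3(\<theta>) z(t + \<theta>) d\<theta>\<close>
  (integrals over \<open>[-1,0]\<close>); \<open>A1\<close> stands for the matrix usually written with index \<open>-1\<close>.
  Note that \<open>mat c ** A\<close> is the scalar multiple of the matrix \<open>A\<close> by the complex number \<open>c\<close>;
  the library's \<open>*s\<close> is only scalar multiplication of vectors.\<close>

definition char_matrix ::
  "complex^'n^'n \<Rightarrow> (real \<Rightarrow> complex^'n^'n) \<Rightarrow> (real \<Rightarrow> complex^'n^'n) \<Rightarrow> complex \<Rightarrow> complex^'n^'n" where
  "char_matrix A1 A2 A3 w =
     mat w - mat (w * exp (- w)) ** A1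
     - matrix_integral (\<lambda>\<theta>. mat (w * exp (w * of_real \<theta>)) ** A2 \<theta>)
     - matrix_integral (\<lambda>\<theta>. mat (exp (w * of_real \<theta>)) ** A3 \<theta>)"

text \<open>Componentwise conjugate: the conjugate transpose of a column vector \<open>v\<close>, so that the row
  vector \<open>v\<^sup>* M\<close> is \<open>vec_cnj v v* M\<close>.\<close>

definition vec_cnj :: "complex^'n \<Rightarrow> complex^'n" where
  "vec_cnj v = (\<chi> i. cnj (v $ i))"

definition log_branch :: "complex \<Rightarrow> int \<Rightarrow> complex" where
  "log_branch \<mu> k = of_real (ln (cmod \<mu>)) + \<i> * of_real (Arg \<mu> + 2 * pi * of_int k)"

end

theory Submission
  imports Defs
begin

text \<open>With \<open>A3 = 0\<close> the characteristic matrix is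
\<open>w (I - e^(-w) A1 - \<integral> e^(w \<theta>) A2(\<theta>) d\<theta>)\<close>. Let \<open>A1\<close> have the left eigenvectors
\<open>z\<^sub>m^*\<close> with eigenvalues \<open>\<mu>\<^sub>m\<close>. Then \<open>d^*\<close> annihilates the characteristic matrix at \<open>\<lambda>\<close> as soon as
\<open>d^* \<integral> e^(\<lambda> \<theta>) A2 = d^* (I - e^(-\<lambda>) A1)\<close>. Column by column this is a moment problem for a
vector of functions in \<open>L\<^sub>2[-1,0]\<close>, with one equation for each pair \<open>(m,k)\<close>, and the right-hand sides are
square summable because \<open>\<lambda>\<^sub>k^m\<close> and \<open>d\<^sub>k^m\<close> are quadratically close to the logarithms \<open>\<sigma>\<^sub>k^m\<close>
of \<open>\<mu>\<^sub>m\<close> and to the eigenvectors \<open>z\<^sub>m\<close>.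

Expand the unknown functions in the exponentials \<open>e^(-\<sigma> \<theta>)\<close>, with vector coefficients in the basis dual to the
\<open>z\<^sub>m\<close>. The moment problem becomes an infinite linear system on \<open>l\<^sub>2\<close>. For \<open>\<lambda> = \<sigma>\<close> and \<open>d = z\<close> its matrix
is the identity; in general it differs from the identity by a Hilbert--Schmidt matrix, by Bessel's inequality
(\<open>moment_row_near_unit\<close>). Hence the system is uniquely solvable once finitely many of its rows, those with
\<open>|k| \<le> N\<close>, are replaced by unit rows, for then the Neumann series converges
(\<open>solvable_rows_near_identity\<close>).

The true rows are put back one at a time. Exchanging row \<open>i\<close> preserves solvability when the new row does not annihilate
the solution \<open>u\<close> of the system with right-hand side the \<open>i\<close>-th unit vector (\<open>solvable_rows_exchange\<close>).
The new row sends \<open>u\<close> to \<open>d^*\<close> applied to \<open>F(\<lambda>\<^sub>i)\<close>, where \<open>F\<close> is the entire vector function with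
coefficients \<open>u\<close>. If \<open>F(\<lambda>\<^sub>i)\<close> vanished, then \<open>F(w) (w - \<sigma>\<^sub>i) / (w - \<lambda>\<^sub>i)\<close> would again be a
function of the same kind, and it would be annihilated by every row of the old system, hence be zero; this is
the classical way of moving a zero of a Paley--Wiener function, and here all \<open>\<lambda>\<close>'s have to be distinct and different
from foreign \<open>\<sigma>\<close>'s (\<open>transform_nonzero_at_new_node\<close>). So \<open>F(\<lambda>\<^sub>i) \<noteq> 0\<close>, the unsuitable vectors
\<open>d\<close> fill only a hyperplane, and either the prescribed vector or an arbitrarily small perturbation of it is suitable
(\<open>solvable_moment_rows\<close>). Finally the Riesz--Fischer theorem turns the solutions in \<open>l\<^sub>2\<close> into the
entries of \<open>A2\<close> (\<open>moment_problem\<close>).\<close>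

section \<open>Square summable families\<close>

definition l2 :: "('i \<Rightarrow> complex) set" where
  "l2 = {a. (\<lambda>i. (cmod (a i))\<^sup>2) summable_on UNIV}"

definition l2norm :: "('i \<Rightarrow> complex) \<Rightarrow> real" where
  "l2norm a = sqrt (\<Sum>\<^sub>\<infinity>i. (cmod (a i))\<^sup>2)"

definition pairing :: "('i \<Rightarrow> complex) \<Rightarrow> ('i \<Rightarrow> complex) \<Rightarrow> complex" where
  "pairing r a = (\<Sum>\<^sub>\<infinity>i. r i * a i)"

lemma l2norm_nonneg [simp]: "0 \<le> l2norm a"
  by (simp add: l2norm_def infsum_nonneg)

lemma l2norm_sq: "(l2norm a)\<^sup>2 = (\<Sum>\<^sub>\<infinity>i. (cmod (a i))\<^sup>2)"
  by (simp add: l2norm_def infsum_nonneg)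

lemma l2_partial_sum_le:
  assumes "a \<in> l2" "finite F"
  shows "(\<Sum>i\<in>F. (cmod (a i))\<^sup>2) \<le> (l2norm a)\<^sup>2"
  unfolding l2norm_sq using assms by (intro finite_sum_le_infsum) (auto simp: l2_def)

lemma cmod_le_l2norm: "a \<in> l2 \<Longrightarrow> cmod (a i) \<le> l2norm a"
  using l2_partial_sum_le[of a "{i}"] by (auto intro: power2_le_imp_le)

lemma nonneg_summable_dominated:
  fixes f g :: "'i \<Rightarrow> real"
  assumes "g summable_on A" "\<And>i. i \<in> A \<Longrightarrow> 0 \<le> f i" "\<And>i. i \<in> A \<Longrightarrow> f i \<le> g i"
  shows "f summable_on A"
  using summable_on_comparison_test[OF assms(1), of f] assms(2,3) by auto

lemma l2_bounded_partial_sums: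
  assumes "\<And>F. finite F \<Longrightarrow> (\<Sum>i\<in>F. (cmod (a i))\<^sup>2) \<le> B\<^sup>2" "0 \<le> B"
  shows "a \<in> l2" "l2norm a \<le> B"
proof -
  show "a \<in> l2" unfolding l2_def mem_Collect_eq
    by (rule nonneg_bdd_above_summable_on) (auto intro!: bdd_aboveI2 assms)
  then have "(l2norm a)\<^sup>2 \<le> B\<^sup>2"
    unfolding l2norm_sq using assms by (intro infsum_le_finite_sums) (auto simp: l2_def)
  then show "l2norm a \<le> B" using assms(2) by (rule power2_le_imp_le)
qed

lemma l2_dominated:
  fixes b :: "'i \<Rightarrow> real"
  assumes b: "(\<lambda>i. (b i)\<^sup>2) summable_on UNIV" and le: "\<And>i. cmod (a i) \<le> C * b i" and "0 \<le> C"
  shows "a \<in> l2" "l2norm a \<le> C * sqrt (\<Sum>\<^sub>\<infinity>i. (b i)\<^sup>2)"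
proof -
  let ?B = "C * sqrt (\<Sum>\<^sub>\<infinity>i. (b i)\<^sup>2)"
  have "(\<Sum>i\<in>F. (cmod (a i))\<^sup>2) \<le> ?B\<^sup>2" if "finite F" for F
  proof -
    have "(\<Sum>i\<in>F. (cmod (a i))\<^sup>2) \<le> (\<Sum>i\<in>F. (C * b i)\<^sup>2)"
      by (intro sum_mono power_mono le) auto
    also have "\<dots> = C\<^sup>2 * (\<Sum>i\<in>F. (b i)\<^sup>2)" by (simp add: sum_distrib_left power_mult_distrib)
    also have "\<dots> \<le> C\<^sup>2 * (\<Sum>\<^sub>\<infinity>i. (b i)\<^sup>2)"
      by (intro mult_left_mono finite_sum_le_infsum b that) auto
    also have "\<dots> = ?B\<^sup>2" by (simp add: power_mult_distrib infsum_nonneg)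
    finally show ?thesis .
  qed
  moreover have "0 \<le> ?B" using assms(3) by (simp add: infsum_nonneg)
  ultimately show "a \<in> l2" "l2norm a \<le> ?B" using l2_bounded_partial_sums[of a ?B] by auto
qed

lemma le_sqrt_infsum_squares:
  fixes b :: "'i \<Rightarrow> real"
  assumes "(\<lambda>i. (b i)\<^sup>2) summable_on UNIV"
  shows "b i \<le> sqrt (\<Sum>\<^sub>\<infinity>i. (b i)\<^sup>2)"
  using finite_sum_le_infsum[OF assms, of "{i}"] by (auto intro: real_le_rsqrt)

lemma l2_add:
  assumes "a \<in> l2" "b \<in> l2" shows "(\<lambda>i. a i + b i) \<in> l2"
proof -
  have "(cmod (a i + b i))\<^sup>2 \<le> 2 * (cmod (a i))\<^sup>2 + 2 * (cmod (b i))\<^sup>2" for i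
  proof -
    have "(cmod (a i + b i))\<^sup>2 \<le> (cmod (a i) + cmod (b i))\<^sup>2"
      by (intro power_mono norm_triangle_ineq) auto
    also have "\<dots> \<le> 2 * (cmod (a i))\<^sup>2 + 2 * (cmod (b i))\<^sup>2"
      using sum_squares_bound[of "cmod (a i)" "cmod (b i)"] by (simp add: power2_sum)
    finally show ?thesis .
  qed
  note le = this
  have sm: "(\<lambda>i. 2 * (cmod (a i))\<^sup>2 + 2 * (cmod (b i))\<^sup>2) summable_on UNIV"
    using assms unfolding l2_def by (intro summable_on_add summable_on_cmult_right) auto
  show ?thesis unfolding l2_def mem_Collect_eq
    by (rule nonneg_summable_dominated[OF sm]) (simp_all add: le)
qed

lemma l2_scale:
  assumes "a \<in> l2" shows "(\<lambda>i. c * a i) \<in> l2"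
  using assms unfolding l2_def
  by (auto simp: norm_mult power_mult_distrib intro!: summable_on_cmult_right)

lemma l2_diff:
  assumes "a \<in> l2" "b \<in> l2" shows "(\<lambda>i. a i - b i) \<in> l2"
  using l2_add[OF assms(1) l2_scale[OF assms(2), of "-1"]] by simp

lemma l2_zero [simp]: "(\<lambda>i. 0) \<in> l2" by (simp add: l2_def)

lemma l2_sum: "finite S \<Longrightarrow> (\<And>s. s \<in> S \<Longrightarrow> f s \<in> l2) \<Longrightarrow> (\<lambda>i. \<Sum>s\<in>S. f s i) \<in> l2"
  by (induction S rule: finite_induct) (auto intro!: l2_add)

lemma l2_finite_change:
  assumes "a \<in> l2" "finite F" "\<And>i. i \<notin> F \<Longrightarrow> b i = a i" shows "b \<in> l2"
proof -
  have "(\<lambda>i. (cmod (a i))\<^sup>2) summable_on (UNIV - F)"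
    using assms(1) by (auto simp: l2_def intro: summable_on_subset)
  then have "(\<lambda>i. (cmod (b i))\<^sup>2) summable_on (UNIV - F)"
    by (subst summable_on_cong[where g = "\<lambda>i. (cmod (a i))\<^sup>2"]) (auto simp: assms)
  then have "(\<lambda>i. (cmod (b i))\<^sup>2) summable_on ((UNIV - F) \<union> F)"
    using assms(2) by (intro summable_on_union) auto
  then show ?thesis by (simp add: l2_def)
qed

lemma Cauchy_Schwarz_l2:
  assumes r: "r \<in> l2" and a: "a \<in> l2"
  shows "(\<lambda>i. r i * a i) summable_on UNIV" "cmod (pairing r a) \<le> l2norm r * l2norm a"
proof -
  have bd: "(\<Sum>i\<in>F. cmod (r i * a i)) \<le> l2norm r * l2norm a" if "finite F" for F
  proof -
    have "(\<Sum>i\<in>F. cmod (r i * a i)) \<le> L2_set (\<lambda>i. cmod (r i)) F * L2_set (\<lambda>i. cmod (a i)) F"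
      using L2_set_mult_ineq[of "\<lambda>i. cmod (r i)" "\<lambda>i. cmod (a i)" F] by (simp add: norm_mult)
    also have "\<dots> \<le> l2norm r * l2norm a"
      unfolding L2_set_def
      using l2_partial_sum_le[OF r that] l2_partial_sum_le[OF a that]
      by (intro mult_mono) (auto intro!: real_le_lsqrt sum_nonneg real_sqrt_ge_zero)
    finally show ?thesis .
  qed
  have s: "(\<lambda>i. cmod (r i * a i)) summable_on UNIV"
    by (rule nonneg_bdd_above_summable_on) (auto intro!: bdd_aboveI2 bd)
  then show "(\<lambda>i. r i * a i) summable_on UNIV" by (rule abs_summable_summable)
  have "cmod (pairing r a) \<le> (\<Sum>\<^sub>\<infinity>i. cmod (r i * a i))"
    unfolding pairing_def using s by (rule norm_infsum_bound)
  also have "\<dots> \<le> l2norm r * l2norm a" by (rule infsum_le_finite_sums[OF s bd])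
  finally show "cmod (pairing r a) \<le> l2norm r * l2norm a" .
qed

lemma pairing_add_right:
  assumes "r \<in> l2" "a \<in> l2" "b \<in> l2"
  shows "pairing r (\<lambda>i. a i + b i) = pairing r a + pairing r b"
  unfolding pairing_def using Cauchy_Schwarz_l2(1) assms
  by (subst infsum_add[symmetric]) (auto simp: algebra_simps)

lemma pairing_scale_right: "pairing r (\<lambda>i. c * a i) = c * pairing r a"
  unfolding pairing_def by (subst infsum_cmult_right'[symmetric]) (simp add: algebra_simps)

lemma pairing_diff_right:
  assumes "r \<in> l2" "a \<in> l2" "b \<in> l2"
  shows "pairing r (\<lambda>i. a i - b i) = pairing r a - pairing r b"
  using pairing_add_right[OF assms(1,2) l2_scale[OF assms(3), of "-1"]]
    pairing_scale_right[of r "-1" b] by simp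

lemma pairing_sum_right:
  assumes "r \<in> l2" "finite S" "\<And>s. s \<in> S \<Longrightarrow> f s \<in> l2"
  shows "pairing r (\<lambda>i. \<Sum>s\<in>S. f s i) = (\<Sum>s\<in>S. pairing r (f s))"
  using assms(2,3)
proof (induction S rule: finite_induct)
  case (insert x S)
  then show ?case
    by (simp add: pairing_add_right[OF assms(1)] l2_sum)
qed (simp add: pairing_def)

lemma pairing_add_left:
  assumes "r \<in> l2" "s \<in> l2" "a \<in> l2"
  shows "pairing (\<lambda>i. r i + s i) a = pairing r a + pairing s a"
  unfolding pairing_def using Cauchy_Schwarz_l2(1) assms
  by (subst infsum_add[symmetric]) (auto simp: algebra_simps)

definition unit_seq :: "'i \<Rightarrow> 'i \<Rightarrow> complex" where
  "unit_seq i = (\<lambda>j. if j = i then 1 else 0)"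

lemma unit_seq_l2 [simp]: "unit_seq i \<in> l2"
  by (rule l2_finite_change[of "\<lambda>_. 0" "{i}"]) (auto simp: unit_seq_def)

lemma pairing_unit_left: "pairing (unit_seq i) a = a i"
proof -
  have "pairing (unit_seq i) a = (\<Sum>\<^sub>\<infinity>j\<in>{i}. unit_seq i j * a j)"
    unfolding pairing_def by (rule infsum_cong_neutral) (auto simp: unit_seq_def)
  then show ?thesis by (simp add: unit_seq_def)
qed

lemma pairing_commute: "pairing r a = pairing a r"
  by (simp add: pairing_def mult.commute)

section \<open>Infinite linear systems close to the identity\<close>

text \<open>The infinite matrix with rows \<open>R i\<close> maps \<open>l2\<close> bijectively onto itself. Surjectivity solves the moment problem;
injectivity is needed on the way, to see that coefficients annihilated by all rows vanish.\<close>

definition solvable_rows :: "('i \<Rightarrow> 'i \<Rightarrow> complex) \<Rightarrow> bool" where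
  "solvable_rows R \<longleftrightarrow> (\<forall>i. R i \<in> l2) \<and> (\<forall>a\<in>l2. (\<lambda>i. pairing (R i) a) \<in> l2)
     \<and> (\<forall>c\<in>l2. \<exists>a\<in>l2. \<forall>i. pairing (R i) a = c i)
     \<and> (\<forall>a\<in>l2. (\<forall>i. pairing (R i) a = 0) \<longrightarrow> a = (\<lambda>_. 0))"

text \<open>The Neumann series, with the error estimated row by row: as \<open>l2norm (K i)\<close> is itself square summable in \<open>i\<close>, the
pointwise bound \<open>cmod (D (Suc n) i) \<le> l2norm (K i) * M * q ^ n\<close> on the terms makes the series converge at every
index, with remainders that tend to zero in \<open>l2\<close>.\<close>

theorem solvable_rows_near_identity:
  fixes K :: "'i \<Rightarrow> 'i \<Rightarrow> complex"
  assumes K: "\<And>i. K i \<in> l2"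
    and HS: "(\<lambda>i. (l2norm (K i))\<^sup>2) summable_on UNIV" "(\<Sum>\<^sub>\<infinity>i. (l2norm (K i))\<^sup>2) < 1"
  shows "solvable_rows (\<lambda>i j. unit_seq i j + K i j)"
proof -
  define q where "q = sqrt (\<Sum>\<^sub>\<infinity>i. (l2norm (K i))\<^sup>2)"
  have q: "0 \<le> q" "q < 1" using HS(2) by (auto simp: q_def infsum_nonneg)
  have row: "pairing (\<lambda>j. unit_seq i j + K i j) a = a i + pairing (K i) a" if "a \<in> l2" for i a
    by (simp add: pairing_add_left K that pairing_unit_left)
  have Kmap: "(\<lambda>i. pairing (K i) y) \<in> l2" "l2norm (\<lambda>i. pairing (K i) y) \<le> q * l2norm y"
    if "y \<in> l2" for y
    using l2_dominated[OF HS(1), of "\<lambda>i. pairing (K i) y" "l2norm y"] Cauchy_Schwarz_l2(2)[OF K that]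
    by (auto simp: q_def mult.commute)
  have rows_l2: "(\<lambda>j. unit_seq i j + K i j) \<in> l2" for i by (intro l2_add K) auto
  have maps: "(\<lambda>i. pairing (\<lambda>j. unit_seq i j + K i j) a) \<in> l2" if "a \<in> l2" for a
    using l2_add[OF that Kmap(1)[OF that]] that by (simp add: row)
  have inj: "a = (\<lambda>_. 0)" if a: "a \<in> l2" "\<forall>i. pairing (\<lambda>j. unit_seq i j + K i j) a = 0" for a
  proof -
    have "pairing (K i) a = - a i" for i using a row[of a i] by (simp add: add_eq_0_iff)
    then have "l2norm a = l2norm (\<lambda>i. pairing (K i) a)" by (simp add: l2norm_def)
    also have "\<dots> \<le> q * l2norm a" by (rule Kmap(2)[OF a(1)])
    finally have "(1 - q) * l2norm a \<le> 0" by (simp add: algebra_simps)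
    then have "l2norm a = 0" using q l2norm_nonneg[of a]
      by (metis diff_gt_0_iff_gt dual_order.antisym mult_le_0_iff not_less)
    then show ?thesis using cmod_le_l2norm[OF a(1)] by auto
  qed
  have surj: "\<exists>a\<in>l2. \<forall>i. pairing (\<lambda>j. unit_seq i j + K i j) a = c i" if c: "c \<in> l2" for c
  proof -
    define D where "D = rec_nat c (\<lambda>_ y i. - pairing (K i) y)"
    have D0: "D 0 = c" and DS: "D (Suc n) = (\<lambda>i. - pairing (K i) (D n))" for n
      by (simp_all add: D_def)
    define M where "M = l2norm c"
    have Dn: "D n \<in> l2 \<and> l2norm (D n) \<le> q ^ n * M" for n
    proof (induction n)
      case (Suc n)
      have "(\<lambda>i. -1 * pairing (K i) (D n)) \<in> l2" by (intro l2_scale Kmap) (use Suc in auto)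
      moreover have "l2norm (D (Suc n)) = l2norm (\<lambda>i. pairing (K i) (D n))"
        by (simp add: l2norm_def DS)
      moreover have "\<dots> \<le> q * (q ^ n * M)"
        using Kmap(2)[of "D n"] Suc q(1) by (meson mult_left_mono order_trans)
      ultimately show ?case by (simp add: DS mult.assoc)
    qed (auto simp: D0 c M_def)
    have Dpt: "cmod (D (Suc n) i) \<le> l2norm (K i) * M * q ^ n" for n i
    proof -
      have "cmod (D (Suc n) i) \<le> l2norm (K i) * l2norm (D n)"
        using Cauchy_Schwarz_l2(2)[OF K] Dn by (simp add: DS)
      also have "\<dots> \<le> l2norm (K i) * (q ^ n * M)" using Dn by (intro mult_left_mono) auto
      finally show ?thesis by (simp add: algebra_simps)
    qed
    have geo: "summable (\<lambda>n. l2norm (K i) * M * q ^ n)" for i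
      using q by (intro summable_mult summable_geometric) auto
    have sm: "summable (\<lambda>n. D (Suc n) i)" for i
      by (rule summable_comparison_test'[OF geo Dpt])
    have sm': "summable (\<lambda>n. D n i)" for i using sm summable_Suc_iff by blast
    define x where "x i = (\<Sum>n. D n i)" for i
    define X where "X n i = (\<Sum>k<n. D k i)" for n i
    have tail: "cmod (x i - X (Suc n) i) \<le> (M * q ^ n / (1 - q)) * l2norm (K i)" for n i
    proof -
      have "x i - X (Suc n) i = (\<Sum>k. D (Suc (k + n)) i)"
        unfolding x_def X_def using suminf_minus_initial_segment[OF sm', of "Suc n" i] by simp
      also have "cmod \<dots> \<le> (\<Sum>k. l2norm (K i) * M * q ^ (k + n))"
      proof (rule norm_suminf_le)
        show "cmod (D (Suc (k + n)) i) \<le> l2norm (K i) * M * q ^ (k + n)" for k by (rule Dpt)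
        show "summable (\<lambda>k. l2norm (K i) * M * q ^ (k + n))" by (rule summable_ignore_initial_segment[OF geo])
      qed
      also have "\<dots> = (\<Sum>k. (l2norm (K i) * M * q ^ n) * q ^ k)" by (simp add: power_add algebra_simps)
      also have "\<dots> = (l2norm (K i) * M * q ^ n) * (1 / (1 - q))"
        using q by (subst suminf_mult) (auto simp: suminf_geometric)
      finally show ?thesis by (simp add: algebra_simps)
    qed
    have tail_l2: "(\<lambda>i. x i - X (Suc n) i) \<in> l2"
        "l2norm (\<lambda>i. x i - X (Suc n) i) \<le> (M * q ^ n / (1 - q)) * q" for n
      using l2_dominated[OF HS(1) tail[of _ n]] q by (auto simp: q_def M_def)
    have X_l2: "X n \<in> l2" for n unfolding X_def[abs_def] using Dn by (intro l2_sum) auto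
    have x_l2: "x \<in> l2" using l2_add[OF tail_l2(1)[of 0] X_l2[of "Suc 0"]] by simp
    have "x i + pairing (K i) x = c i" for i
    proof -
      have XS: "X (Suc n) i = c i - pairing (K i) (X n)" for n
      proof -
        have "pairing (K i) (X n) = (\<Sum>k<n. pairing (K i) (D k))"
          unfolding X_def[abs_def] using Dn K by (intro pairing_sum_right) auto
        moreover have "X (Suc n) i = D 0 i + (\<Sum>k<n. D (Suc k) i)"
          unfolding X_def by (rule sum.lessThan_Suc_shift)
        ultimately show ?thesis by (simp add: D0 DS sum_negf)
      qed
      have lim1: "(\<lambda>n. X n i) \<longlonglongrightarrow> x i" unfolding X_def x_def by (rule summable_LIMSEQ[OF sm'])
      have "(\<lambda>n. pairing (K i) (X (Suc n)) - pairing (K i) x) \<longlonglongrightarrow> 0"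
      proof (rule Lim_null_comparison)
        show "\<forall>\<^sub>F n in sequentially. norm (pairing (K i) (X (Suc n)) - pairing (K i) x)
            \<le> l2norm (K i) * ((M * q ^ n / (1 - q)) * q)"
        proof (intro always_eventually allI)
          fix n
          have "norm (pairing (K i) (X (Suc n)) - pairing (K i) x)
              = norm (pairing (K i) (\<lambda>j. x j - X (Suc n) j))"
            by (simp add: pairing_diff_right K x_l2 X_l2 norm_minus_commute)
          also have "\<dots> \<le> l2norm (K i) * l2norm (\<lambda>j. x j - X (Suc n) j)"
            by (rule Cauchy_Schwarz_l2(2)[OF K tail_l2(1)])
          also have "\<dots> \<le> l2norm (K i) * ((M * q ^ n / (1 - q)) * q)"
            by (intro mult_left_mono tail_l2(2)) auto
          finally show "norm (pairing (K i) (X (Suc n)) - pairing (K i) x)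
            \<le> l2norm (K i) * ((M * q ^ n / (1 - q)) * q)" .
        qed
        have "(\<lambda>n. q ^ n) \<longlonglongrightarrow> 0" using q by (intro LIMSEQ_power_zero) auto
        then have "(\<lambda>n. (l2norm (K i) * M / (1 - q) * q) * q ^ n) \<longlonglongrightarrow> 0"
          by (rule tendsto_mult_right_zero)
        then show "(\<lambda>n. l2norm (K i) * ((M * q ^ n / (1 - q)) * q)) \<longlonglongrightarrow> 0"
          by (simp add: algebra_simps)
      qed
      then have "(\<lambda>n. pairing (K i) (X (Suc n))) \<longlonglongrightarrow> pairing (K i) x" by (rule LIM_zero_cancel)
      then have "(\<lambda>n. X (Suc (Suc n)) i) \<longlonglongrightarrow> c i - pairing (K i) x"
        unfolding XS by (intro tendsto_intros)
      moreover have "(\<lambda>n. X (Suc (Suc n)) i) \<longlonglongrightarrow> x i"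
        by (intro LIMSEQ_Suc lim1)
      ultimately have "x i = c i - pairing (K i) x" by (rule LIMSEQ_unique[rotated])
      then show ?thesis by simp
    qed
    then show ?thesis using x_l2 by (auto simp: row)
  qed
  show ?thesis unfolding solvable_rows_def using rows_l2 maps inj surj by auto
qed

text \<open>Adding a multiple of \<open>u\<close> to a solution of the old system changes the value of row \<open>i\<close> only, and as
\<open>r\<close> does not annihilate \<open>u\<close>, the multiple can be chosen to give the new row any prescribed value.\<close>

theorem solvable_rows_exchange:
  assumes R: "solvable_rows R" and u: "u \<in> l2" "\<And>j. pairing (R j) u = unit_seq i j"
    and r: "r \<in> l2" "pairing r u \<noteq> 0"
  shows "solvable_rows (R(i := r))"
proof -
  have R_l2: "R j \<in> l2" for j using R by (simp add: solvable_rows_def)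
  have R_map: "(\<lambda>j. pairing (R j) a) \<in> l2" if "a \<in> l2" for a using R that by (simp add: solvable_rows_def)
  have R_inj: "a = (\<lambda>_. 0)" if "a \<in> l2" "\<And>j. pairing (R j) a = 0" for a
    using R that by (simp add: solvable_rows_def)
  have maps: "(\<lambda>j. pairing ((R(i := r)) j) a) \<in> l2" if "a \<in> l2" for a
    by (rule l2_finite_change[OF R_map[OF that], of "{i}"]) auto
  have surj: "\<exists>a\<in>l2. \<forall>j. pairing ((R(i := r)) j) a = c j" if c: "c \<in> l2" for c
  proof -
    obtain b where b: "b \<in> l2" "\<And>j. pairing (R j) b = c j"
      using R c by (auto simp: solvable_rows_def)
    define t where "t = (c i - pairing r b) / pairing r u"
    define a where "a = (\<lambda>k. b k + t * u k)"
    have pa: "pairing s a = pairing s b + t * pairing s u" if "s \<in> l2" for s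
      unfolding a_def
      using pairing_add_right[OF that b(1) l2_scale[OF u(1), of t]] by (simp add: pairing_scale_right)
    have "a \<in> l2" unfolding a_def by (intro l2_add b l2_scale u)
    moreover have "pairing ((R(i := r)) j) a = c j" for j
      using r by (cases "j = i") (auto simp: pa R_l2 b u unit_seq_def t_def)
    ultimately show ?thesis by blast
  qed
  have inj: "a = (\<lambda>_. 0)" if a: "a \<in> l2" "\<And>j. pairing ((R(i := r)) j) a = 0" for a
  proof -
    define t where "t = pairing (R i) a"
    have "pairing (R j) (\<lambda>k. a k - t * u k) = 0" for j
      using a(2)[of j] by (cases "j = i")
        (auto simp: pairing_diff_right pairing_scale_right R_l2 a(1) l2_scale u unit_seq_def t_def)
    then have "(\<lambda>k. a k - t * u k) = (\<lambda>_. 0)" by (intro R_inj l2_diff a l2_scale u)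
    then have eq: "a = (\<lambda>k. t * u k)" by (auto simp: fun_eq_iff)
    then have "t * pairing r u = 0" using a(2)[of i] by (simp add: pairing_scale_right)
    then show ?thesis using r(2) eq by auto
  qed
  show ?thesis unfolding solvable_rows_def using maps inj surj R_l2 r by (auto simp: fun_upd_def)
qed

section \<open>Exponential moments on the unit interval\<close>

abbreviation unit_ivl :: "real measure" where "unit_ivl \<equiv> lebesgue_on {-1..0}"

text \<open>The moment of \<open>exp (- \<sigma> \<theta>)\<close> against \<open>exp (w \<theta>)\<close> is \<open>phi (w - \<sigma>)\<close>.\<close>

definition phi :: "complex \<Rightarrow> complex" where
  "phi s = (LINT \<theta>|unit_ivl. exp (s * of_real \<theta>))"

lemma integrable_exp [simp]: "integrable unit_ivl (\<lambda>\<theta>. exp (s * of_real \<theta>) :: complex)"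
  by (intro continuous_imp_integrable_real continuous_intros)

lemma phi_eq:
  assumes "s \<noteq> 0" shows "phi s = (1 - exp (- s)) / s"
proof -
  have "((\<lambda>\<theta>. exp (s * of_real \<theta>)) has_integral (exp (s * of_real 0) / s - exp (s * of_real (-1)) / s)) {-1..0}"
  proof (rule fundamental_theorem_of_calculus)
    fix x :: real assume "x \<in> {-1..0}"
    have "((\<lambda>\<theta>. exp (s * \<theta>) / s) has_field_derivative exp (s * of_real x)) (at (of_real x))"
      using assms by (auto intro!: derivative_eq_intros)
    from has_vector_derivative_real_field[OF this]
    show "((\<lambda>\<theta>. exp (s * of_real \<theta>) / s) has_vector_derivative exp (s * of_real x)) (at x within {-1..0})"
      by (simp add: has_vector_derivative_at_within)
  qed auto
  then have "integral {-1..0} (\<lambda>\<theta>. exp (s * of_real \<theta>)) = (1 - exp (- s)) / s"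
    by (simp add: integral_unique diff_divide_distrib)
  then show ?thesis unfolding phi_def by (subst lebesgue_integral_eq_integral) auto
qed

lemma measure_unit_ivl [simp]: "measure unit_ivl {-1..0} = 1"
  by (simp add: measure_restrict_space)

lemma finite_measure_unit_ivl: "finite_measure unit_ivl"
  by (rule finite_measureI) (simp add: emeasure_restrict_space)

lemma integral_const_unit_ivl [simp]: "(LINT \<theta>|unit_ivl. c) = (c :: 'a :: {banach, second_countable_topology})"
  by simp

lemma integrable_const_unit_ivl [simp]: "integrable unit_ivl (\<lambda>_. c :: 'a :: {banach, second_countable_topology})"
  using finite_measure.integrable_const[OF finite_measure_unit_ivl] by blast

lemma phi_0 [simp]: "phi 0 = 1" by (simp add: phi_def)

lemma phi_nonzero: assumes "exp s \<noteq> 1" shows "phi s \<noteq> 0"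
proof -
  have "s \<noteq> 0" using assms by auto
  moreover have "exp (- s) \<noteq> 1" using assms by (simp add: exp_minus)
  ultimately show ?thesis by (simp add: phi_eq)
qed

definition freq :: "int \<Rightarrow> complex" where "freq l = 2 * of_real pi * of_int l * \<i>"

lemma exp_freq [simp]: "exp (freq l) = 1"
  unfolding freq_def exp_eq_1 by (auto intro!: exI[of _ l])

lemma freq_diff: "freq k - freq l = freq (k - l)" by (simp add: freq_def algebra_simps)
lemma freq_minus: "- freq l = freq (- l)" by (simp add: freq_def)
lemma cnj_freq: "cnj (freq l) = freq (- l)" by (simp add: freq_def)
lemma freq_eq_0 [simp]: "freq l = 0 \<longleftrightarrow> l = 0" by (simp add: freq_def)

lemma phi_freq: "phi (freq l) = (if l = 0 then 1 else 0)"
proof (cases "l = 0")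
  case True
  then have "freq l = 0" by simp
  then have "phi (freq l) = 1" by (simp only: phi_0)
  then show ?thesis using True by simp
qed (simp add: phi_eq freq_minus)

definition trig_poly :: "int set \<Rightarrow> (int \<Rightarrow> complex) \<Rightarrow> real \<Rightarrow> complex" where
  "trig_poly F c \<theta> = (\<Sum>l\<in>F. c l * exp (- freq l * of_real \<theta>))"

lemma continuous_trig_poly: "continuous_on S (trig_poly F c)"
  unfolding trig_poly_def[abs_def] by (intro continuous_intros)

lemma trig_poly_moment:
  "(LINT \<theta>|unit_ivl. exp (s * of_real \<theta>) * trig_poly F c \<theta>) = (\<Sum>l\<in>F. c l * phi (s - freq l))"
proof -
  have "exp (s * of_real \<theta>) * trig_poly F c \<theta> = (\<Sum>l\<in>F. c l * exp ((s - freq l) * of_real \<theta>))" for \<theta>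
    by (simp add: trig_poly_def sum_distrib_left algebra_simps exp_diff exp_minus divide_inverse)
  then show ?thesis by (simp add: phi_def)
qed

lemma trig_poly_norm:
  assumes "finite F"
  shows "(LINT \<theta>|unit_ivl. (cmod (trig_poly F c \<theta>))\<^sup>2) = (\<Sum>l\<in>F. (cmod (c l))\<^sup>2)"
proof -
  have "complex_of_real ((cmod (trig_poly F c \<theta>))\<^sup>2)
      = (\<Sum>k\<in>F. cnj (c k) * (exp (freq k * of_real \<theta>) * trig_poly F c \<theta>))" for \<theta>
  proof -
    have "cnj (trig_poly F c \<theta>) = (\<Sum>k\<in>F. cnj (c k) * exp (freq k * of_real \<theta>))"
      by (simp add: trig_poly_def exp_cnj cnj_freq freq_minus)
    then have "trig_poly F c \<theta> * cnj (trig_poly F c \<theta>)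
      = (\<Sum>k\<in>F. cnj (c k) * (exp (freq k * of_real \<theta>) * trig_poly F c \<theta>))"
      by (simp add: sum_distrib_left sum_distrib_right algebra_simps)
    then show ?thesis using complex_norm_square[of "trig_poly F c \<theta>"] by simp
  qed
  then have "complex_of_real (LINT \<theta>|unit_ivl. (cmod (trig_poly F c \<theta>))\<^sup>2)
      = (LINT \<theta>|unit_ivl. (\<Sum>k\<in>F. cnj (c k) * (exp (freq k * of_real \<theta>) * trig_poly F c \<theta>)))"
    by (subst integral_complex_of_real[symmetric]) simp
  also have "\<dots> = (\<Sum>k\<in>F. cnj (c k) * (\<Sum>l\<in>F. c l * phi (freq k - freq l)))"
  proof -
    have "integrable unit_ivl (\<lambda>\<theta>. exp (freq k * of_real \<theta>) * trig_poly F c \<theta>)" for k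
      by (intro continuous_imp_integrable_real continuous_intros continuous_trig_poly)
    then show ?thesis by (simp add: trig_poly_moment)
  qed
  also have "\<dots> = (\<Sum>k\<in>F. cnj (c k) * c k)"
    unfolding freq_diff phi_freq
    by (intro sum.cong refl arg_cong2[where f = "(*)"])
       (simp add: if_distrib[where f = "\<lambda>x. _ * x"] assms sum.delta' cong: if_cong)
  also have "\<dots> = complex_of_real (\<Sum>l\<in>F. (cmod (c l))\<^sup>2)"
    by (simp add: complex_norm_square mult.commute del: of_real_power)
  finally show ?thesis using of_real_eq_iff by blast
qed

text \<open>With \<open>P\<close> the trigonometric polynomial whose coefficients are the conjugates of the \<open>c l\<close>, the finite sum \<open>S\<close> of the
\<open>(cmod (c l))\<^sup>2\<close> equals both \<open>\<integral> h P\<close> and \<open>\<integral> |P|\<^sup>2\<close>. As \<open>|h P| \<le> (B\<^sup>2 + |P|\<^sup>2) / 2\<close>, this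
gives \<open>S \<le> (B\<^sup>2 + S) / 2\<close>.\<close>

theorem Bessel_inequality:
  fixes h :: "real \<Rightarrow> complex"
  assumes h: "continuous_on {-1..0} h" and bound: "\<And>\<theta>. \<theta> \<in> {-1..0} \<Longrightarrow> cmod (h \<theta>) \<le> B" and B: "0 \<le> B"
  defines "c \<equiv> \<lambda>l. (LINT \<theta>|unit_ivl. h \<theta> * exp (- freq l * of_real \<theta>))"
  shows "c \<in> l2" "l2norm c \<le> B"
proof -
  have "(\<Sum>l\<in>F. (cmod (c l))\<^sup>2) \<le> B\<^sup>2" if F: "finite F" for F
  proof -
    let ?P = "trig_poly F (\<lambda>l. cnj (c l))"
    let ?N = "\<Sum>l\<in>F. (cmod (c l))\<^sup>2"
    have int: "integrable unit_ivl (\<lambda>\<theta>. h \<theta> * exp (- freq l * of_real \<theta>))" for l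
      by (intro continuous_imp_integrable_real continuous_intros h)
    have intP: "integrable unit_ivl (\<lambda>\<theta>. (cmod (?P \<theta>))\<^sup>2)"
      by (intro continuous_imp_integrable_real continuous_intros continuous_trig_poly)
    have inthP: "integrable unit_ivl (\<lambda>\<theta>. h \<theta> * ?P \<theta>)"
      by (intro continuous_imp_integrable_real continuous_intros continuous_trig_poly h)
    have "complex_of_real ?N = (\<Sum>l\<in>F. cnj (c l) * c l)"
      by (simp add: complex_norm_square mult.commute del: of_real_power)
    also have "\<dots> = (LINT \<theta>|unit_ivl. (\<Sum>l\<in>F. cnj (c l) * (h \<theta> * exp (- freq l * of_real \<theta>))))"
      using int by (simp add: c_def)
    also have "\<dots> = (LINT \<theta>|unit_ivl. h \<theta> * ?P \<theta>)"
      by (simp add: trig_poly_def sum_distrib_left algebra_simps)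
    finally have eq: "complex_of_real ?N = (LINT \<theta>|unit_ivl. h \<theta> * ?P \<theta>)" .
    have "?N = cmod (complex_of_real ?N)" unfolding norm_of_real by (simp add: sum_nonneg)
    then have "?N = cmod (LINT \<theta>|unit_ivl. h \<theta> * ?P \<theta>)" unfolding eq .
    also have "\<dots> \<le> (LINT \<theta>|unit_ivl. cmod (h \<theta> * ?P \<theta>))" by (rule integral_norm_bound)
    also have "\<dots> \<le> (LINT \<theta>|unit_ivl. (B\<^sup>2 + (cmod (?P \<theta>))\<^sup>2) / 2)"
    proof (rule integral_mono)
      show "integrable unit_ivl (\<lambda>\<theta>. cmod (h \<theta> * ?P \<theta>))" using inthP by (rule integrable_norm)
      show "integrable unit_ivl (\<lambda>\<theta>. (B\<^sup>2 + (cmod (?P \<theta>))\<^sup>2) / 2)"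
        using intP by (intro integrable_divide_zero Bochner_Integration.integrable_add) auto
      fix \<theta> assume "\<theta> \<in> space unit_ivl"
      then have "\<theta> \<in> {-1..0}" by (simp add: space_restrict_space)
      then have "cmod (h \<theta> * ?P \<theta>) \<le> B * cmod (?P \<theta>)"
        using bound by (simp add: norm_mult mult_right_mono)
      also have "\<dots> \<le> (B\<^sup>2 + (cmod (?P \<theta>))\<^sup>2) / 2" using sum_squares_bound[of B "cmod (?P \<theta>)"] by simp
      finally show "cmod (h \<theta> * ?P \<theta>) \<le> (B\<^sup>2 + (cmod (?P \<theta>))\<^sup>2) / 2" .
    qed
    also have "\<dots> = (B\<^sup>2 + ?N) / 2"
      using intP trig_poly_norm[OF F, of "\<lambda>l. cnj (c l)"] by simp
    finally show ?thesis by simp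
  qed
  then show "c \<in> l2" "l2norm c \<le> B" using l2_bounded_partial_sums[of c B] B by auto
qed

lemma norm_exp_minus_1_le: "cmod (exp z - 1) \<le> cmod z * exp (cmod z)"
proof -
  have "cmod (exp z - 1) \<le> exp \<bar>Re z\<bar> * cmod z" using Taylor_exp[of z 0] by simp
  also have "\<dots> \<le> exp (cmod z) * cmod z" by (intro mult_right_mono) (auto simp: abs_Re_le_cmod)
  finally show ?thesis by (simp add: mult.commute)
qed

text \<open>The numbers \<open>phi (s - freq l)\<close> are the Fourier coefficients of \<open>exp (s \<theta>)\<close>.\<close>

lemma phi_row_l2:
  shows "(\<lambda>l. phi (s - freq l)) \<in> l2" "l2norm (\<lambda>l. phi (s - freq l)) \<le> exp \<bar>Re s\<bar>"
proof -
  have eq: "phi (s - freq l) = (LINT \<theta>|unit_ivl. exp (s * of_real \<theta>) * exp (- freq l * of_real \<theta>))" for l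
    by (simp add: phi_def algebra_simps exp_diff exp_minus divide_inverse)
  have "Re s * \<theta> \<le> \<bar>Re s\<bar>" if "\<theta> \<in> {-1..0}" for \<theta>
  proof -
    have "Re s * \<theta> \<le> \<bar>Re s\<bar> * \<bar>\<theta>\<bar>" by (metis abs_ge_self abs_mult)
    also have "\<dots> \<le> \<bar>Re s\<bar> * 1" using that by (intro mult_left_mono) auto
    finally show ?thesis by simp
  qed
  then have "cmod (exp (s * of_real \<theta>)) \<le> exp \<bar>Re s\<bar>" if "\<theta> \<in> {-1..0}" for \<theta>
    using that by simp
  moreover have "continuous_on {-1..0} (\<lambda>\<theta>. exp (s * of_real \<theta>))" by (intro continuous_intros)
  ultimately show "(\<lambda>l. phi (s - freq l)) \<in> l2" "l2norm (\<lambda>l. phi (s - freq l)) \<le> exp \<bar>Re s\<bar>"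
    using Bessel_inequality[of "\<lambda>\<theta>. exp (s * of_real \<theta>)" "exp \<bar>Re s\<bar>"] by (simp_all add: eq)
qed

lemma phi_row_diff_l2:
  shows "l2norm (\<lambda>l. phi (freq k + d - freq l) - phi (freq k - freq l)) \<le> cmod d * exp (cmod d)"
proof -
  define h where "h \<theta> = exp ((freq k + d) * of_real \<theta>) - exp (freq k * of_real \<theta>)" for \<theta> :: real
  have eq: "phi (freq k + d - freq l) - phi (freq k - freq l)
      = (LINT \<theta>|unit_ivl. h \<theta> * exp (- freq l * of_real \<theta>))" for l
  proof -
    have "h \<theta> * exp (- freq l * of_real \<theta>)
       = exp ((freq k + d - freq l) * of_real \<theta>) - exp ((freq k - freq l) * of_real \<theta>)" for \<theta>
      unfolding h_def by (simp add: left_diff_distrib mult_exp_exp algebra_simps)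
    then show ?thesis by (simp add: phi_def)
  qed
  have bd: "cmod (h \<theta>) \<le> cmod d * exp (cmod d)" if "\<theta> \<in> {-1..0}" for \<theta>
  proof -
    have "h \<theta> = exp (freq k * of_real \<theta>) * (exp (d * of_real \<theta>) - 1)"
      by (simp add: h_def algebra_simps exp_add)
    then have "cmod (h \<theta>) = cmod (exp (d * of_real \<theta>) - 1)"
      by (simp add: norm_mult freq_def)
    also have "\<dots> \<le> cmod (d * of_real \<theta>) * exp (cmod (d * of_real \<theta>))"
      by (rule norm_exp_minus_1_le)
    also have "\<dots> \<le> cmod d * exp (cmod d)"
    proof -
      have "cmod (d * of_real \<theta>) \<le> cmod d * 1"
        unfolding norm_mult using that by (intro mult_left_mono) auto
      then show ?thesis by (intro mult_mono) auto
    qed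
    finally show ?thesis .
  qed
  show ?thesis unfolding eq
  proof (rule Bessel_inequality(2)[OF _ bd])
    show "continuous_on {-1..0} h" unfolding h_def[abs_def] by (intro continuous_intros)
  qed auto
qed

section \<open>The Riesz--Fischer theorem\<close>

definition symm :: "nat \<Rightarrow> int set" where "symm n = {- int n..int n}"

lemma finite_symm [simp]: "finite (symm n)" by (simp add: symm_def)

lemma symm_mono: "m \<le> n \<Longrightarrow> symm m \<subseteq> symm n" by (auto simp: symm_def)

lemma symm_exhausts: "filterlim symm (finite_subsets_at_top UNIV) sequentially"
  unfolding filterlim_finite_subsets_at_top
proof (intro allI impI)
  fix X :: "int set" assume "finite X \<and> X \<subseteq> UNIV"
  then have fin: "finite ((\<lambda>x. nat \<bar>x\<bar>) ` X)" by simp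
  have "X \<subseteq> symm n" if "Max (insert 0 ((\<lambda>x. nat \<bar>x\<bar>) ` X)) \<le> n" for n
  proof
    fix x assume "x \<in> X"
    then have "nat \<bar>x\<bar> \<le> n" using that fin by simp
    then show "x \<in> symm n" by (auto simp: symm_def)
  qed
  then show "\<forall>\<^sub>F n in sequentially. finite (symm n) \<and> X \<subseteq> symm n \<and> symm n \<subseteq> UNIV"
    by (auto simp: eventually_sequentially)
qed

lemma has_sum_imp_tendsto_symm:
  "(f has_sum S) UNIV \<Longrightarrow> (\<lambda>n. sum f (symm n)) \<longlonglongrightarrow> S"
  unfolding has_sum_def by (rule filterlim_compose[OF _ symm_exhausts])

lemma norm_exp_unit_ivl_le:
  assumes "\<theta> \<in> {-1..0}" shows "cmod (exp (s * of_real \<theta>)) \<le> exp (cmod s)"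
proof -
  have "cmod (exp (s * of_real \<theta>)) \<le> exp (cmod (s * of_real \<theta>))" by (rule norm_exp)
  also have "cmod (s * of_real \<theta>) \<le> cmod s * 1"
    unfolding norm_mult using assms by (intro mult_left_mono) auto
  finally show ?thesis by simp
qed

lemma integrable_exp_mult:
  assumes g: "integrable unit_ivl g"
  shows "integrable unit_ivl (\<lambda>\<theta>. exp (s * of_real \<theta>) * g \<theta> :: complex)"
proof (rule Bochner_Integration.integrable_bound)
  show "integrable unit_ivl (\<lambda>\<theta>. exp (cmod s) * cmod (g \<theta>))" using g by auto
  show "(\<lambda>\<theta>. exp (s * of_real \<theta>) * g \<theta>) \<in> borel_measurable unit_ivl"
    by (intro borel_measurable_times borel_measurable_integrable g integrable_exp)
  show "AE \<theta> in unit_ivl. norm (exp (s * of_real \<theta>) * g \<theta>) \<le> norm (exp (cmod s) * cmod (g \<theta>))"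
  proof (rule AE_I2)
    fix \<theta> assume "\<theta> \<in> space unit_ivl"
    then have "\<theta> \<in> {-1..0}" by (simp add: space_restrict_space)
    then have "cmod (exp (s * of_real \<theta>)) * cmod (g \<theta>) \<le> exp (cmod s) * cmod (g \<theta>)"
      by (intro mult_right_mono norm_exp_unit_ivl_le) auto
    then show "norm (exp (s * of_real \<theta>) * g \<theta>) \<le> norm (exp (cmod s) * cmod (g \<theta>))"
      unfolding norm_mult by simp
  qed
qed

text \<open>The function is the \<open>L\<^sub>1\<close> limit of a subsequence of the symmetric partial sums \<open>X k\<close> of the Fourier series, chosen such
that the squared norms of the increments \<open>D k\<close> are at most \<open>(1/4) ^ k\<close>. Convergence in \<open>L\<^sub>1\<close> and almost
everywhere suffices: the moments are limits because the exponentials are bounded on the interval, and square integrability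
follows from Fatou's lemma.\<close>

theorem Riesz_Fischer:
  fixes a :: "int \<Rightarrow> complex"
  assumes a: "a \<in> l2"
  obtains g where "g \<in> borel_measurable unit_ivl" "integrable unit_ivl (\<lambda>\<theta>. (cmod (g \<theta>))\<^sup>2)"
    "\<And>s. integrable unit_ivl (\<lambda>\<theta>. exp (s * of_real \<theta>) * g \<theta>)"
    "\<And>s. (LINT \<theta>|unit_ivl. exp (s * of_real \<theta>) * g \<theta>) = pairing (\<lambda>l. phi (s - freq l)) a"
proof -
  define E where "E F = (\<Sum>l\<in>F. (cmod (a l))\<^sup>2)" for F
  let ?S = "(l2norm a)\<^sup>2"
  have E_le: "E F \<le> ?S" if "finite F" for F unfolding E_def by (rule l2_partial_sum_le[OF a that])
  have "(\<lambda>n. E (symm n)) \<longlonglongrightarrow> ?S"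
    unfolding E_def l2norm_sq using a by (intro has_sum_imp_tendsto_symm has_sum_infsum) (simp add: l2_def)
  note E_lim = this
  have "\<exists>n0. \<forall>n\<ge>n0. ?S - E (symm n) < (1/4) ^ k" for k
  proof -
    have "\<forall>\<^sub>F n in sequentially. ?S - (1/4) ^ k < E (symm n)"
      by (rule order_tendstoD(1)[OF E_lim]) simp
    then obtain n0 where "\<forall>n\<ge>n0. ?S - (1/4) ^ k < E (symm n)"
      unfolding eventually_sequentially by blast
    then have "\<forall>n\<ge>n0. ?S - E (symm n) < (1/4) ^ k" by (auto simp: algebra_simps)
    then show ?thesis by blast
  qed
  then obtain n0 where n0: "\<And>k n. n0 k \<le> n \<Longrightarrow> ?S - E (symm n) < (1/4) ^ k" by metis
  \<comment> \<open>Adding up the indices makes the sequence monotone; the summand k makes it unbounded.\<close>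
  define r where "r k = k + (\<Sum>j\<le>k. n0 j)" for k
  have r_mono: "r k \<le> r (Suc k)" for k unfolding r_def by (intro add_mono sum_mono2) auto
  have r_tail: "?S - E (symm (r k)) < (1/4) ^ k" for k
  proof (rule n0)
    have "n0 k \<le> (\<Sum>j\<le>k. n0 j)" by (rule member_le_sum) auto
    then show "n0 k \<le> r k" unfolding r_def by (rule trans_le_add2)
  qed
  have r_lim: "filterlim r sequentially sequentially"
  proof (rule filterlim_at_top_mono[OF filterlim_ident])
    show "\<forall>\<^sub>F k in sequentially. k \<le> r k" unfolding r_def by (intro always_eventually allI le_add1)
  qed
  define F where "F k = symm (r k)" for k
  have F_fin [simp]: "finite (F k)" for k by (simp add: F_def)
  have F_mono: "F k \<subseteq> F (Suc k)" for k unfolding F_def by (intro symm_mono r_mono)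
  define X where "X k = trig_poly (F k) a" for k
  define D where "D k = trig_poly (F (Suc k) - F k) a" for k
  have D_eq: "D k \<theta> = X (Suc k) \<theta> - X k \<theta>" for k \<theta>
    unfolding D_def X_def trig_poly_def by (rule sum_diff) (use F_mono in auto)
  have D_int: "integrable unit_ivl (D k)" and D_sq: "integrable unit_ivl (\<lambda>\<theta>. (cmod (D k \<theta>))\<^sup>2)"
    and X_int: "integrable unit_ivl (X k)" and X_sq: "integrable unit_ivl (\<lambda>\<theta>. (cmod (X k \<theta>))\<^sup>2)" for k
    unfolding D_def X_def
    by (intro continuous_imp_integrable_real continuous_intros continuous_trig_poly)+
  \<comment> \<open>Square norms control first norms on an interval of length 1, by the inequality of the two means with weight t.\<close>
  have D_L1: "(LINT \<theta>|unit_ivl. cmod (D k \<theta>)) \<le> (1/2) ^ k" for k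
  proof -
    define t :: real where "t = (1/2) ^ k"
    have t: "t > 0" "(1/4) ^ k = t * t" by (auto simp: t_def simp flip: power_mult_distrib)
    have "(LINT \<theta>|unit_ivl. cmod (D k \<theta>)) \<le> (LINT \<theta>|unit_ivl. (t + (cmod (D k \<theta>))\<^sup>2 / t) / 2)"
    proof (rule integral_mono)
      fix \<theta>
      have "cmod (D k \<theta>) * t \<le> (t\<^sup>2 + (cmod (D k \<theta>))\<^sup>2) / 2"
        using sum_squares_bound[of t "cmod (D k \<theta>)"] by (simp add: algebra_simps)
      then have "cmod (D k \<theta>) \<le> ((t\<^sup>2 + (cmod (D k \<theta>))\<^sup>2) / 2) / t"
        using t(1) by (subst pos_le_divide_eq)
      also have "\<dots> = (t + (cmod (D k \<theta>))\<^sup>2 / t) / 2"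
        using t(1) by (simp add: add_divide_distrib power2_eq_square)
      finally show "cmod (D k \<theta>) \<le> (t + (cmod (D k \<theta>))\<^sup>2 / t) / 2" .
    qed (use D_int D_sq in auto)
    also have "\<dots> = (t + E (F (Suc k) - F k) / t) / 2"
      using D_sq[of k] trig_poly_norm[of "F (Suc k) - F k" a] by (simp add: D_def E_def)
    also have "E (F (Suc k) - F k) = E (F (Suc k)) - E (F k)"
      unfolding E_def by (rule sum_diff) (use F_mono in auto)
    also have "\<dots> \<le> t * t"
      using E_le[of "F (Suc k)"] r_tail[of k] by (simp add: F_def t)
    finally show ?thesis using t(1) by (simp add: divide_right_mono t_def)
  qed
  have D_summable: "summable (\<lambda>k. LINT \<theta>|unit_ivl. cmod (D k \<theta>))"
    by (rule summable_comparison_test'[of "\<lambda>k. (1/2) ^ k" 0]) (auto simp: D_L1 summable_geometric)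
  have AE_summable: "AE \<theta> in unit_ivl. summable (\<lambda>k. cmod (D k \<theta>))"
  proof -
    have "(\<integral>\<^sup>+\<theta>. (\<Sum>k. ennreal (cmod (D k \<theta>))) \<partial>unit_ivl) = (\<Sum>k. \<integral>\<^sup>+\<theta>. ennreal (cmod (D k \<theta>)) \<partial>unit_ivl)"
      using D_int by (intro nn_integral_suminf) (auto dest: borel_measurable_integrable)
    also have "\<dots> = (\<Sum>k. ennreal (LINT \<theta>|unit_ivl. cmod (D k \<theta>)))"
      using D_int by (intro suminf_cong nn_integral_eq_integral) auto
    also have "\<dots> \<noteq> \<infinity>" using D_summable by (simp add: ennreal_suminf_neq_top)
    finally have "AE \<theta> in unit_ivl. (\<Sum>k. ennreal (cmod (D k \<theta>))) \<noteq> \<infinity>"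
      using D_int by (intro nn_integral_noteq_infinite) (auto dest: borel_measurable_integrable)
    then show ?thesis by eventually_elim (auto intro: summable_suminf_not_top)
  qed
  define G where "G \<theta> = (\<Sum>k. D k \<theta>)" for \<theta>
  define g where "g \<theta> = X 0 \<theta> + G \<theta>" for \<theta>
  have X_sum: "X k \<theta> = X 0 \<theta> + (\<Sum>j<k. D j \<theta>)" for k \<theta>
    by (induction k) (auto simp: D_eq)
  have AE_lim: "AE \<theta> in unit_ivl. (\<lambda>k. X k \<theta>) \<longlonglongrightarrow> g \<theta>"
    using AE_summable
  proof eventually_elim
    case (elim \<theta>)
    then have "summable (\<lambda>k. D k \<theta>)" by (rule summable_norm_cancel)
    moreover have "(\<lambda>k. X k \<theta>) = (\<lambda>k. X 0 \<theta> + (\<Sum>j<k. D j \<theta>))" by (rule ext) (rule X_sum)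
    ultimately show ?case unfolding g_def G_def by (simp add: tendsto_add summable_LIMSEQ)
  qed
  have g_int: "integrable unit_ivl g" unfolding g_def[abs_def] G_def
    by (intro Bochner_Integration.integrable_add X_int integrable_suminf D_int AE_summable D_summable)
  then have g_meas: "g \<in> borel_measurable unit_ivl" by (rule borel_measurable_integrable)
  have g_sq: "integrable unit_ivl (\<lambda>\<theta>. (cmod (g \<theta>))\<^sup>2)"
  proof (rule integrableI_bounded)
    show "(\<lambda>\<theta>. (cmod (g \<theta>))\<^sup>2) \<in> borel_measurable unit_ivl" using g_meas by measurable
    have "(\<integral>\<^sup>+\<theta>. ennreal (norm ((cmod (g \<theta>))\<^sup>2)) \<partial>unit_ivl)
        = (\<integral>\<^sup>+\<theta>. liminf (\<lambda>k. ennreal ((cmod (X k \<theta>))\<^sup>2)) \<partial>unit_ivl)"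
    proof (rule nn_integral_cong_AE, use AE_lim in eventually_elim)
      case (elim \<theta>)
      have "(\<lambda>k. ennreal ((cmod (X k \<theta>))\<^sup>2)) \<longlonglongrightarrow> ennreal ((cmod (g \<theta>))\<^sup>2)"
        by (intro tendsto_ennrealI tendsto_intros elim)
      from lim_imp_Liminf[OF sequentially_bot this] show ?case by simp
    qed
    also have "\<dots> \<le> liminf (\<lambda>k. \<integral>\<^sup>+\<theta>. ennreal ((cmod (X k \<theta>))\<^sup>2) \<partial>unit_ivl)"
      using X_sq by (intro nn_integral_liminf) (auto dest!: borel_measurable_integrable)
    also have "(\<lambda>k. \<integral>\<^sup>+\<theta>. ennreal ((cmod (X k \<theta>))\<^sup>2) \<partial>unit_ivl) = (\<lambda>k. ennreal (E (F k)))"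
      using nn_integral_eq_integral[OF X_sq] trig_poly_norm[OF F_fin, of _ a] by (simp add: X_def E_def)
    also have "liminf (\<lambda>k. ennreal (E (F k))) \<le> liminf (\<lambda>k. ennreal ?S)"
      by (intro Liminf_mono always_eventually allI ennreal_leI E_le F_fin)
    also have "\<dots> < \<infinity>" by (simp add: Liminf_const)
    finally show "(\<integral>\<^sup>+\<theta>. ennreal (norm ((cmod (g \<theta>))\<^sup>2)) \<partial>unit_ivl) < \<infinity>" .
  qed
  have moment: "(LINT \<theta>|unit_ivl. exp (s * of_real \<theta>) * g \<theta>) = pairing (\<lambda>l. phi (s - freq l)) a" for s
  proof -
    let ?e = "\<lambda>\<theta>. exp (s * of_real \<theta>) :: complex"
    have lim1: "(\<lambda>k. LINT \<theta>|unit_ivl. ?e \<theta> * X k \<theta>) \<longlonglongrightarrow> (LINT \<theta>|unit_ivl. ?e \<theta> * g \<theta>)"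
    proof -
      have nb: "cmod (?e \<theta> * x) \<le> exp (cmod s) * cmod x" if "\<theta> \<in> {-1..0}" for \<theta> x
        using norm_exp_unit_ivl_le[OF that, of s] by (simp add: norm_mult mult_right_mono)
      have eD: "integrable unit_ivl (\<lambda>\<theta>. ?e \<theta> * D k \<theta>)" for k by (intro integrable_exp_mult D_int)
      have s1: "AE \<theta> in unit_ivl. summable (\<lambda>k. norm (?e \<theta> * D k \<theta>))"
        using AE_summable by eventually_elim (simp add: norm_mult summable_mult)
      have s2: "summable (\<lambda>k. LINT \<theta>|unit_ivl. norm (?e \<theta> * D k \<theta>))"
      proof (rule summable_comparison_test'[of "\<lambda>k. exp (cmod s) * (LINT \<theta>|unit_ivl. cmod (D k \<theta>))" 0])
        show "summable (\<lambda>k. exp (cmod s) * (LINT \<theta>|unit_ivl. cmod (D k \<theta>)))"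
          by (intro summable_mult D_summable)
        fix k
        have "(LINT \<theta>|unit_ivl. norm (?e \<theta> * D k \<theta>)) \<le> (LINT \<theta>|unit_ivl. exp (cmod s) * cmod (D k \<theta>))"
          by (rule integral_mono) (use eD D_int nb in \<open>auto simp: space_restrict_space simp del: norm_mult\<close>)
        then show "norm (LINT \<theta>|unit_ivl. norm (?e \<theta> * D k \<theta>)) \<le> exp (cmod s) * (LINT \<theta>|unit_ivl. cmod (D k \<theta>))"
          by simp
      qed
      have "(\<lambda>k. LINT \<theta>|unit_ivl. ?e \<theta> * D k \<theta>) sums (LINT \<theta>|unit_ivl. (\<Sum>k. ?e \<theta> * D k \<theta>))"
        by (rule sums_integral[OF eD s1 s2])
      then have "(\<lambda>k. \<Sum>j<k. LINT \<theta>|unit_ivl. ?e \<theta> * D j \<theta>) \<longlonglongrightarrow> (LINT \<theta>|unit_ivl. (\<Sum>k. ?e \<theta> * D k \<theta>))"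
        by (simp add: sums_def)
      then have "(\<lambda>k. (LINT \<theta>|unit_ivl. ?e \<theta> * X 0 \<theta>) + (\<Sum>j<k. LINT \<theta>|unit_ivl. ?e \<theta> * D j \<theta>))
          \<longlonglongrightarrow> (LINT \<theta>|unit_ivl. ?e \<theta> * X 0 \<theta>) + (LINT \<theta>|unit_ivl. (\<Sum>k. ?e \<theta> * D k \<theta>))"
        by (intro tendsto_intros)
      moreover have "(LINT \<theta>|unit_ivl. ?e \<theta> * X 0 \<theta>) + (\<Sum>j<k. LINT \<theta>|unit_ivl. ?e \<theta> * D j \<theta>)
          = (LINT \<theta>|unit_ivl. ?e \<theta> * X k \<theta>)" for k
        unfolding X_sum[of k] using eD integrable_exp_mult[OF X_int]
        by (simp add: distrib_left sum_distrib_left)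
      moreover have "(LINT \<theta>|unit_ivl. ?e \<theta> * X 0 \<theta>) + (LINT \<theta>|unit_ivl. (\<Sum>k. ?e \<theta> * D k \<theta>))
          = (LINT \<theta>|unit_ivl. ?e \<theta> * g \<theta>)"
      proof -
        have "(LINT \<theta>|unit_ivl. ?e \<theta> * X 0 \<theta>) + (LINT \<theta>|unit_ivl. (\<Sum>k. ?e \<theta> * D k \<theta>))
            = (LINT \<theta>|unit_ivl. ?e \<theta> * X 0 \<theta> + (\<Sum>k. ?e \<theta> * D k \<theta>))"
          by (rule Bochner_Integration.integral_add[symmetric, OF integrable_exp_mult[OF X_int]
                integrable_suminf[OF eD s1 s2]])
        also have "\<dots> = (LINT \<theta>|unit_ivl. ?e \<theta> * g \<theta>)"
        proof (rule integral_cong_AE)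
          show "(\<lambda>\<theta>. ?e \<theta> * X 0 \<theta> + (\<Sum>k. ?e \<theta> * D k \<theta>)) \<in> borel_measurable unit_ivl"
            by (intro borel_measurable_integrable Bochner_Integration.integrable_add integrable_exp_mult[OF X_int]
                integrable_suminf[OF eD s1 s2])
          show "(\<lambda>\<theta>. ?e \<theta> * g \<theta>) \<in> borel_measurable unit_ivl"
            by (intro borel_measurable_integrable integrable_exp_mult g_int)
          show "AE \<theta> in unit_ivl. ?e \<theta> * X 0 \<theta> + (\<Sum>k. ?e \<theta> * D k \<theta>) = ?e \<theta> * g \<theta>"
            using AE_summable
          proof eventually_elim
            case (elim \<theta>)
            then have "summable (\<lambda>k. D k \<theta>)" by (rule summable_norm_cancel)
            then show ?case by (simp add: g_def G_def suminf_mult distrib_left)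
          qed
        qed
        finally show ?thesis .
      qed
      ultimately show ?thesis by simp
    qed
    have "((\<lambda>l. phi (s - freq l) * a l) has_sum pairing (\<lambda>l. phi (s - freq l)) a) UNIV"
      unfolding pairing_def by (intro has_sum_infsum Cauchy_Schwarz_l2(1) phi_row_l2 a)
    from filterlim_compose[OF has_sum_imp_tendsto_symm[OF this] r_lim]
    have lim2: "(\<lambda>k. LINT \<theta>|unit_ivl. ?e \<theta> * X k \<theta>) \<longlonglongrightarrow> pairing (\<lambda>l. phi (s - freq l)) a"
      by (simp add: X_def trig_poly_moment F_def mult.commute)
    show ?thesis by (rule LIMSEQ_unique[OF lim1 lim2])
  qed
  show ?thesis by (rule that[OF g_meas g_sq integrable_exp_mult[OF g_int] moment])
qed

section \<open>Rows of the moment problem\<close>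

lemma l2norm_triangle:
  assumes "a \<in> l2" "b \<in> l2"
  shows "l2norm (\<lambda>i. a i + b i) \<le> l2norm a + l2norm b"
proof (rule l2_bounded_partial_sums(2))
  fix F :: "'a set" assume F: "finite F"
  have le: "L2_set (\<lambda>i. cmod (f i)) F \<le> l2norm f" if "f \<in> l2" for f
    unfolding L2_set_def using l2_partial_sum_le[OF that F] by (intro real_le_lsqrt) (auto intro: sum_nonneg)
  have "L2_set (\<lambda>i. cmod (a i + b i)) F \<le> L2_set (\<lambda>i. cmod (a i) + cmod (b i)) F"
    by (intro L2_set_mono norm_triangle_ineq) auto
  also have "\<dots> \<le> L2_set (\<lambda>i. cmod (a i)) F + L2_set (\<lambda>i. cmod (b i)) F" by (rule L2_set_triangle_ineq)
  also have "\<dots> \<le> l2norm a + l2norm b" by (intro add_mono le assms)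
  finally have "(L2_set (\<lambda>i. cmod (a i + b i)) F)\<^sup>2 \<le> (l2norm a + l2norm b)\<^sup>2"
    by (intro power_mono) auto
  then show "(\<Sum>i\<in>F. (cmod (a i + b i))\<^sup>2) \<le> (l2norm a + l2norm b)\<^sup>2"
    by (simp add: L2_set_def sum_nonneg)
qed auto

lemma l2norm_scale: "l2norm (\<lambda>i. c * a i) = cmod c * l2norm a"
  by (simp add: l2norm_def norm_mult power_mult_distrib infsum_cmult_right' real_sqrt_mult)

lemma has_sum_finite_product:
  fixes f :: "'n::finite \<times> 'k \<Rightarrow> 'b::{topological_comm_monoid_add,t2_space}"
  assumes "\<And>p. (\<lambda>l. f (p, l)) summable_on UNIV"
  shows "(f has_sum (\<Sum>p\<in>UNIV. \<Sum>\<^sub>\<infinity>l. f (p, l))) UNIV"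
proof -
  have "(f has_sum (\<Sum>\<^sub>\<infinity>l. f (p, l))) (range (Pair p))" for p
    by (subst has_sum_reindex) (auto simp: o_def inj_on_def assms)
  then have "(f has_sum (\<Sum>p\<in>UNIV. \<Sum>\<^sub>\<infinity>l. f (p, l))) (\<Union>p. range (Pair p))"
    by (intro sum_has_sum) auto
  moreover have "(\<Union>p. range (Pair p)) = (UNIV :: ('n \<times> 'k) set)" by auto
  ultimately show ?thesis by simp
qed

lemma l2_finite_product:
  fixes f :: "'n::finite \<times> 'k \<Rightarrow> complex"
  assumes "\<And>p. (\<lambda>l. f (p, l)) \<in> l2"
  shows "f \<in> l2" "(l2norm f)\<^sup>2 = (\<Sum>p\<in>UNIV. (l2norm (\<lambda>l. f (p, l)))\<^sup>2)"
  using has_sum_finite_product[of "\<lambda>i. (cmod (f i))\<^sup>2"] assms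
  by (auto simp: l2_def l2norm_sq infsumI dest: has_sum_imp_summable)

lemma l2_slice:
  assumes "f \<in> l2" shows "(\<lambda>l. f (p, l)) \<in> l2"
proof -
  have "(\<lambda>i. (cmod (f i))\<^sup>2) summable_on (range (Pair p))"
    using assms by (auto simp: l2_def intro: summable_on_subset)
  then show ?thesis by (subst (asm) summable_on_reindex) (auto simp: inj_on_def l2_def o_def)
qed

lemma pairing_finite_product:
  fixes f :: "'n::finite \<times> 'k \<Rightarrow> complex"
  assumes "f \<in> l2" "a \<in> l2"
  shows "pairing f a = (\<Sum>p\<in>UNIV. pairing (\<lambda>l. f (p, l)) (\<lambda>l. a (p, l)))"
  unfolding pairing_def
  by (rule infsumI[OF has_sum_finite_product]) (intro Cauchy_Schwarz_l2(1) l2_slice assms)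

lemma small_tail:
  fixes g :: "'i \<Rightarrow> real"
  assumes g: "g summable_on UNIV" "\<And>i. 0 \<le> g i" and e: "\<epsilon> > 0"
  obtains X where "finite X"
    "\<And>H. X \<subseteq> H \<Longrightarrow> (\<lambda>i. if i \<in> H then 0 else g i) summable_on UNIV
       \<and> (\<Sum>\<^sub>\<infinity>i. if i \<in> H then 0 else g i) \<le> \<epsilon>"
proof -
  obtain X where X: "finite X" "dist (sum g X) (infsum g UNIV) \<le> \<epsilon>"
    using infsum_finite_approximation[OF g(1) e] by blast
  have "(\<lambda>i. if i \<in> H then 0 else g i) summable_on UNIV
       \<and> (\<Sum>\<^sub>\<infinity>i. if i \<in> H then 0 else g i) \<le> \<epsilon>" if H: "X \<subseteq> H" for H
  proof -
    let ?g = "\<lambda>i. if i \<in> H then 0 else g i"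
    have sm: "?g summable_on UNIV" by (rule nonneg_summable_dominated[OF g(1)]) (auto simp: g)
    have "sum ?g F \<le> \<epsilon>" if F: "finite F" for F
    proof -
      have "sum ?g F = sum g (F - H)" using F by (intro sum.mono_neutral_cong_right) auto
      also have "\<dots> = sum g ((F - H) \<union> X) - sum g X"
        using H F X(1) by (subst sum.union_disjoint) auto
      also have "\<dots> \<le> infsum g UNIV - sum g X"
        using F X(1) by (intro diff_right_mono finite_sum_le_infsum g) auto
      also have "\<dots> \<le> \<epsilon>" using X(2) by (simp add: dist_real_def)
      finally show ?thesis .
    qed
    then show ?thesis using sm by (auto intro: infsum_le_finite_sums)
  qed
  then show ?thesis using that X(1) by blast
qed

text \<open>The points \<open>\<alpha> p + 2 \<pi> \<i> l\<close>, that is, all logarithms of \<open>exp (\<alpha> p)\<close>.\<close>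

definition node :: "('n \<Rightarrow> complex) \<Rightarrow> 'n \<times> int \<Rightarrow> complex" where
  "node \<alpha> = (\<lambda>(p, l). \<alpha> p + freq l)"

text \<open>The functional that assigns to coefficients \<open>a\<close> the number \<open>\<Sum>\<^sub>p y\<^sub>p \<integral> e^(s \<theta>) f\<^sub>p(\<theta>) d\<theta>\<close>, where
\<open>f\<^sub>p\<close> is the sum of the \<open>a (p, l) * exp (- node \<alpha> (p, l) * \<theta>)\<close>. At a node, with \<open>y\<close> the corresponding
unit vector, it is a coordinate functional (\<open>unit_seq_eq_phi\<close>).\<close>

definition moment_row :: "('n \<Rightarrow> complex) \<Rightarrow> complex^'n \<Rightarrow> complex \<Rightarrow> 'n \<times> int \<Rightarrow> complex" where
  "moment_row \<alpha> y s = (\<lambda>i. y $ fst i * phi (s - node \<alpha> i))"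

lemma phi_node_l2: "(\<lambda>l. phi (s - node \<alpha> (p, l))) \<in> l2"
  using phi_row_l2(1)[of "s - \<alpha> p"] by (simp add: node_def diff_diff_eq)

lemma l2norm_phi_node: "l2norm (\<lambda>l. phi (s - node \<alpha> (p, l))) \<le> exp \<bar>Re (s - \<alpha> p)\<bar>"
  using phi_row_l2(2)[of "s - \<alpha> p"] by (simp add: node_def diff_diff_eq)

lemma moment_row_l2: "moment_row \<alpha> y s \<in> (l2 :: ('n::finite \<times> int \<Rightarrow> complex) set)"
  by (rule l2_finite_product) (simp add: moment_row_def l2_scale phi_node_l2)

lemma pairing_moment_row:
  assumes "a \<in> l2"
  shows "pairing (moment_row \<alpha> y s) a
    = (\<Sum>p\<in>UNIV. y $ p * pairing (\<lambda>l. phi (s - node \<alpha> (p, l))) (\<lambda>l. a (p, l)))"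
proof -
  have "pairing (\<lambda>l. c * r l) b = c * pairing r b" for c and r b :: "int \<Rightarrow> complex"
    using pairing_scale_right[of b c r] by (simp add: pairing_commute)
  then show ?thesis
    unfolding pairing_finite_product[OF moment_row_l2 assms] by (simp add: moment_row_def)
qed

lemma exp_diff_node: "exp (s - node \<alpha> i) = exp (s - \<alpha> (fst i))"
proof -
  have "exp (s - node \<alpha> i) = exp (s - \<alpha> (fst i)) * exp (- freq (snd i))"
    unfolding node_def by (simp add: case_prod_beta mult_exp_exp algebra_simps)
  then show ?thesis by (simp add: freq_minus)
qed

lemma unit_seq_eq_phi: "unit_seq (m, k) (p, l) = axis m 1 $ p * phi (node \<alpha> (m, k) - node \<alpha> (p, l))"
  by (cases "m = p") (auto simp: unit_seq_def axis_def node_def freq_diff phi_freq)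

text \<open>The row deviates from the unit row for two reasons: the deviation of \<open>y\<close> from the unit vector (term \<open>?u\<close> below) and the distance of
\<open>s\<close> from its node (term \<open>?v\<close>). Bessel's inequality bounds either part, uniformly in \<open>k\<close>, and linearly in the
deviation, so that square summable deviations give a Hilbert--Schmidt matrix.\<close>

lemma moment_row_near_unit:
  fixes \<alpha> :: "'n::finite \<Rightarrow> complex"
  assumes A: "\<And>p. cmod (\<alpha> p) \<le> A" and D: "cmod (s - node \<alpha> (m, k)) \<le> D"
  shows "l2norm (\<lambda>i. moment_row \<alpha> y s i - unit_seq (m, k) i)
    \<le> sqrt (real CARD('n)) * exp (2 * A + D) * (norm (y - axis m 1) + cmod (s - node \<alpha> (m, k)))"
proof -
  define d where "d = s - node \<alpha> (m, k)"
  define b where "b = norm (y - axis m 1) + cmod d"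
  have "0 \<le> A" using A[of m] norm_ge_zero order_trans by blast
  have D0: "0 \<le> D" using D norm_ge_zero order_trans by blast
  let ?K = "\<lambda>i. moment_row \<alpha> y s i - unit_seq (m, k) i"
  have slice: "l2norm (\<lambda>l. ?K (p, l)) \<le> exp (2 * A + D) * b" for p
  proof -
    let ?u = "\<lambda>l. (y - axis m 1) $ p * phi (s - node \<alpha> (p, l))"
    let ?v = "\<lambda>l. axis m 1 $ p * (phi (freq k + d - freq l) - phi (freq k - freq l))"
    have eq: "?K (p, l) = ?u l + ?v l" for l
    proof (cases "p = m")
      case True
      have e: "s - node \<alpha> (m, l) = freq k + d - freq l" "node \<alpha> (m, k) - node \<alpha> (m, l) = freq k - freq l"
        by (simp_all add: d_def node_def)
      have "?K (m, l) = y $ m * phi (s - node \<alpha> (m, l)) - phi (node \<alpha> (m, k) - node \<alpha> (m, l))"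
        by (simp add: moment_row_def unit_seq_eq_phi[of m k m l \<alpha>] axis_def)
      then show ?thesis unfolding True e by (simp add: axis_def ring_distribs)
    next
      case False
      then show ?thesis by (simp add: axis_def unit_seq_def moment_row_def)
    qed
    have u: "?u \<in> l2" "l2norm ?u \<le> norm (y - axis m 1) * exp (2 * A + D)"
    proof -
      show "?u \<in> l2" by (intro l2_scale phi_node_l2)
      have "\<bar>Re (s - \<alpha> p)\<bar> \<le> 2 * A + D"
      proof -
        have "s - \<alpha> p = \<alpha> m - \<alpha> p + freq k + d" by (simp add: d_def node_def)
        then have "\<bar>Re (s - \<alpha> p)\<bar> \<le> \<bar>Re (\<alpha> m)\<bar> + \<bar>Re (\<alpha> p)\<bar> + \<bar>Re d\<bar>" by (simp add: freq_def)
        also have "\<dots> \<le> A + A + D"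
          using abs_Re_le_cmod[of "\<alpha> m"] abs_Re_le_cmod[of "\<alpha> p"] abs_Re_le_cmod[of d] A[of m] A[of p] D
          unfolding d_def by linarith
        finally show ?thesis by simp
      qed
      then have "l2norm (\<lambda>l. phi (s - node \<alpha> (p, l))) \<le> exp (2 * A + D)"
        using l2norm_phi_node[of s \<alpha> p] by (meson exp_le_cancel_iff order_trans)
      then show "l2norm ?u \<le> norm (y - axis m 1) * exp (2 * A + D)"
        unfolding l2norm_scale by (intro mult_mono Finite_Cartesian_Product.norm_nth_le) auto
    qed
    have v: "?v \<in> l2" "l2norm ?v \<le> cmod d * exp (2 * A + D)"
    proof -
      have "(\<lambda>l. phi (freq k + d - freq l) - phi (freq k - freq l)) \<in> l2"
        by (intro l2_diff phi_row_l2)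
      then show "?v \<in> l2" by (rule l2_scale)
      have "l2norm ?v \<le> 1 * (cmod d * exp (cmod d))"
        unfolding l2norm_scale by (intro mult_mono phi_row_diff_l2) (auto simp: axis_def)
      also have "\<dots> \<le> cmod d * exp (2 * A + D)"
        using D \<open>0 \<le> A\<close> by (simp add: d_def mult_left_mono)
      finally show "l2norm ?v \<le> cmod d * exp (2 * A + D)" .
    qed
    show ?thesis unfolding eq using l2norm_triangle[OF u(1) v(1)] u(2) v(2)
      by (simp add: b_def algebra_simps)
  qed
  have Kl2: "?K \<in> l2" by (intro l2_diff moment_row_l2 unit_seq_l2)
  have "(l2norm ?K)\<^sup>2 = (\<Sum>p\<in>UNIV. (l2norm (\<lambda>l. ?K (p, l)))\<^sup>2)"
    by (rule l2_finite_product(2)[OF l2_slice[OF Kl2]])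
  also have "\<dots> \<le> (\<Sum>p\<in>(UNIV :: 'n set). (exp (2 * A + D) * b)\<^sup>2)"
    by (intro sum_mono power_mono slice) auto
  also have "\<dots> = (sqrt (real CARD('n)) * exp (2 * A + D) * b)\<^sup>2"
    by (simp add: power_mult_distrib)
  finally have "l2norm ?K \<le> sqrt (real CARD('n)) * exp (2 * A + D) * b"
    by (rule power2_le_imp_le) (simp add: b_def)
  then show ?thesis by (simp add: b_def d_def)
qed

lemma exp_ne_1_off_nodes:
  assumes "\<And>j. s \<noteq> node \<alpha> j" shows "exp (s - \<alpha> p) \<noteq> 1"
proof
  assume "exp (s - \<alpha> p) = 1"
  then obtain l :: int where l: "Re (s - \<alpha> p) = 0" "Im (s - \<alpha> p) = of_int (2 * l) * pi"
    unfolding exp_eq_1 by blast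
  have "s - \<alpha> p = freq l" by (rule complex_eqI) (use l in \<open>auto simp: freq_def\<close>)
  then have "s = node \<alpha> (p, l)" by (simp add: node_def algebra_simps)
  then show False using assms by blast
qed

lemma inverse_node_diff:
  assumes "\<And>j. w \<noteq> node \<alpha> j"
  shows "1 / (node \<alpha> j - w) = - phi (w - node \<alpha> j) / (1 - exp (- (w - \<alpha> (fst j))))"
proof -
  have ne: "w - node \<alpha> j \<noteq> 0" using assms[of j] by simp
  have "exp (- (w - \<alpha> (fst j))) \<noteq> 1"
    using exp_ne_1_off_nodes[OF assms, of "fst j"] by (simp only: exp_minus inverse_eq_1_iff not_False_eq_True)
  moreover have "phi (w - node \<alpha> j) = (1 - exp (- (w - \<alpha> (fst j)))) / (w - node \<alpha> j)"
    unfolding phi_eq[OF ne] using exp_diff_node[of w \<alpha> j] by (simp only: exp_minus)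
  ultimately show ?thesis using ne
    by (simp add: divide_simps) (simp add: algebra_simps)?
qed

text \<open>Dividing coefficients by \<open>node \<alpha> j - w\<close> amounts to dividing the transform by \<open>s - w\<close>, up to a multiple of the value of the
transform at \<open>w\<close>. The factor of that value depends on the first component of \<open>j\<close> only, since
\<open>exp\<close> is constant along the nodes with that component.\<close>

lemma phi_partial_fraction:
  assumes w: "\<And>j. w \<noteq> node \<alpha> j" and sw: "s \<noteq> w"
  shows "phi (s - node \<alpha> j) / (node \<alpha> j - w)
    = (phi (s - node \<alpha> j) - (1 - exp (- (s - \<alpha> (fst j)))) / (1 - exp (- (w - \<alpha> (fst j)))) * phi (w - node \<alpha> j)) / (s - w)"
proof -
  define n where "n = node \<alpha> j"
  define cs where "cs = 1 - exp (- (s - \<alpha> (fst j)))"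
  define cw where "cw = 1 - exp (- (w - \<alpha> (fst j)))"
  have nw: "n - w \<noteq> 0" using w[of j] by (simp add: n_def)
  have inv: "cs / cw * phi (w - n) = - cs / (n - w)"
    using inverse_node_diff[OF w, of j] unfolding n_def cw_def
    by (metis (no_types, opaque_lifting) divide_minus_left minus_minus mult.commute times_divide_eq_right
        mult_minus_right times_divide_eq_left mult_1_right)
  have "phi (s - n) / (n - w) = (phi (s - n) + cs / (n - w)) / (s - w)"
  proof (cases "s = n")
    case True
    have "exp (- (s - \<alpha> (fst j))) = 1"
      unfolding exp_minus using exp_diff_node[of s \<alpha> j] True by (simp add: n_def)
    then show ?thesis using True by (simp add: cs_def)
  next
    case False
    then have sn: "s - n \<noteq> 0" by simp
    have "phi (s - n) = cs / (s - n)"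
      unfolding phi_eq[OF sn] unfolding cs_def n_def using exp_diff_node[of s \<alpha> j] by (simp only: exp_minus)
    moreover have "cs / (s - n) / (n - w) = (cs / (s - n) + cs / (n - w)) / (s - w)"
      using sn nw sw by (simp add: divide_simps) (simp add: algebra_simps)?
    ultimately show ?thesis by simp
  qed
  then show ?thesis
    unfolding n_def[symmetric] cs_def[symmetric] cw_def[symmetric] inv by simp
qed

section \<open>Exchanging rows\<close>

text \<open>Suppose that the transform of \<open>u\<close> vanished at \<open>w\<close> in all components. Then the zero at \<open>w\<close> can be moved to the node of
\<open>i\<close>: the coefficients \<open>u j * (node \<alpha> j - node \<alpha> i) / (node \<alpha> j - w)\<close> have the transform of
\<open>u\<close> multiplied by \<open>(s - node \<alpha> i) / (s - w)\<close>. All rows annihilate these coefficients, row \<open>i\<close> because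
its coordinate is zero. So they vanish, and \<open>u\<close> is concentrated at \<open>i\<close>; but the transform of a single exponential
has its zeros at translates by multiples of \<open>2 \<pi> \<i>\<close> only, and \<open>w\<close> is not a node. When \<open>w\<close> is the
node of \<open>i\<close> itself, the transform there has the coordinate \<open>u i = 1\<close>.\<close>

lemma transform_nonzero_at_new_node:
  fixes \<alpha> :: "'n::finite \<Rightarrow> complex"
  assumes inj: "inj (node \<alpha>)" and R: "solvable_rows R"
    and u: "u \<in> l2" "\<And>j. pairing (R j) u = unit_seq i j"
    and Ri: "R i = unit_seq i"
    and rows: "\<And>j. j \<noteq> i \<Longrightarrow> R j = unit_seq j \<or> (\<exists>y s. s \<noteq> w \<and> R j = moment_row \<alpha> y s)"
    and w: "\<And>j. w = node \<alpha> j \<Longrightarrow> j = i"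
  shows "\<exists>p. pairing (\<lambda>l. phi (w - node \<alpha> (p, l))) (\<lambda>l. u (p, l)) \<noteq> 0"
proof (rule ccontr)
  assume "\<not> ?thesis"
  then have F0: "pairing (\<lambda>l. phi (w - node \<alpha> (p, l))) (\<lambda>l. u (p, l)) = 0" for p by blast
  have ui: "u i = 1" using u(2)[of i] by (simp add: Ri pairing_unit_left) (simp add: unit_seq_def)
  obtain m k where i: "i = (m, k)" by (cases i)
  show False
  proof (cases "w = node \<alpha> i")
    case True
    have "(\<lambda>l. phi (w - node \<alpha> (m, l))) = unit_seq k"
      by (auto simp: True i node_def freq_diff phi_freq unit_seq_def)
    then show False using F0[of m] ui by (simp add: pairing_unit_left i)
  next
    case False
    then have off: "\<And>j. w \<noteq> node \<alpha> j" using w by blast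
    define c where "c p = 1 - exp (- (w - \<alpha> p))" for p
    define b where "b j = u j / (node \<alpha> j - w)" for j
    define v where "v j = u j + (w - node \<alpha> i) * b j" for j
    have b_eq: "b j = (- 1 / c (fst j)) * (phi (w - node \<alpha> j) * u j)" for j
      using inverse_node_diff[OF off, of j] by (simp add: b_def c_def divide_inverse mult.assoc)
    have b_l2: "b \<in> l2"
    proof (rule l2_finite_product)
      fix p
      let ?B = "cmod (- 1 / c p) * exp \<bar>Re (w - \<alpha> p)\<bar>"
      show "(\<lambda>l. b (p, l)) \<in> l2"
      proof (rule l2_dominated(1)[where b = "\<lambda>l. cmod (u (p, l))" and C = ?B])
        show "(\<lambda>l. (cmod (u (p, l)))\<^sup>2) summable_on UNIV" using l2_slice[OF u(1)] by (simp add: l2_def)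
        fix l
        have "cmod (phi (w - node \<alpha> (p, l))) \<le> exp \<bar>Re (w - \<alpha> p)\<bar>"
          using cmod_le_l2norm[OF phi_node_l2[of w \<alpha> p], of l] l2norm_phi_node[of w \<alpha> p] by linarith
        then have "cmod (- 1 / c p) * (cmod (phi (w - node \<alpha> (p, l))) * cmod (u (p, l)))
            \<le> cmod (- 1 / c p) * (exp \<bar>Re (w - \<alpha> p)\<bar> * cmod (u (p, l)))"
          by (intro mult_left_mono mult_right_mono) auto
        then show "cmod (b (p, l)) \<le> ?B * cmod (u (p, l))"
          unfolding b_eq norm_mult fst_conv by (simp only: mult.assoc)
      qed simp
    qed
    have v_l2: "v \<in> l2" unfolding v_def[abs_def] by (intro l2_add u l2_scale b_l2)
    have v_eq: "v j = u j * (node \<alpha> j - node \<alpha> i) / (node \<alpha> j - w)" for j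
    proof -
      have "node \<alpha> j - w \<noteq> 0" using off[of j] by simp
      then show ?thesis by (simp add: v_def b_def divide_simps) (simp add: algebra_simps)
    qed
    have unit_zero: "pairing (unit_seq j) v = 0" if "R j = unit_seq j" for j
    proof (cases "j = i")
      case True then show ?thesis by (simp add: pairing_unit_left v_eq)
    next
      case False
      then have "u j = 0" using u(2)[of j] that by (simp add: pairing_unit_left) (simp add: unit_seq_def)
      then show ?thesis by (simp add: pairing_unit_left v_eq)
    qed
    have row_zero: "pairing (moment_row \<alpha> y s) v = 0"
      if j: "j \<noteq> i" "R j = moment_row \<alpha> y s" and s: "s \<noteq> w" for j y s
    proof -
      have ru: "pairing (moment_row \<alpha> y s) u = 0" using u(2)[of j] j by (simp add: unit_seq_def)
      have slice: "pairing (\<lambda>l. phi (s - node \<alpha> (p, l))) (\<lambda>l. b (p, l))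
          = pairing (\<lambda>l. phi (s - node \<alpha> (p, l))) (\<lambda>l. u (p, l)) / (s - w)" for p
      proof -
        let ?q = "(1 - exp (- (s - \<alpha> p))) / c p"
        let ?u = "\<lambda>l. u (p, l)"
        have "pairing (\<lambda>l. phi (s - node \<alpha> (p, l))) (\<lambda>l. b (p, l))
          = pairing ?u (\<lambda>l. (1 / (s - w)) * (phi (s - node \<alpha> (p, l)) - ?q * phi (w - node \<alpha> (p, l))))"
          unfolding pairing_def
        proof (rule infsum_cong)
          fix l :: int
          have "phi (s - node \<alpha> (p, l)) * b (p, l) = u (p, l) * (phi (s - node \<alpha> (p, l)) / (node \<alpha> (p, l) - w))"
            by (simp add: b_def)
          also have "\<dots> = u (p, l) * ((1 / (s - w)) * (phi (s - node \<alpha> (p, l)) - ?q * phi (w - node \<alpha> (p, l))))"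
            unfolding phi_partial_fraction[OF off s] by (simp add: c_def)
          finally show "phi (s - node \<alpha> (p, l)) * b (p, l) = \<dots>" .
        qed
        also have "\<dots> = (1 / (s - w)) * (pairing ?u (\<lambda>l. phi (s - node \<alpha> (p, l)))
            - ?q * pairing ?u (\<lambda>l. phi (w - node \<alpha> (p, l))))"
          unfolding pairing_scale_right
            pairing_diff_right[OF l2_slice[OF u(1)] phi_node_l2 l2_scale[OF phi_node_l2]] ..
        finally show ?thesis using F0[of p] by (simp add: pairing_commute)
      qed
      have "pairing (moment_row \<alpha> y s) b = pairing (moment_row \<alpha> y s) u / (s - w)"
        unfolding pairing_moment_row[OF b_l2] pairing_moment_row[OF u(1)] slice
        by (simp add: sum_divide_distrib)
      then show ?thesis unfolding v_def[abs_def]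
        using pairing_add_right[OF moment_row_l2 u(1) l2_scale[OF b_l2, of "w - node \<alpha> i"]] ru
        by (simp add: pairing_scale_right)
    qed
    have "pairing (R j) v = 0" for j
      using rows[of j] unit_zero[of j] row_zero[of j] Ri by (cases "j = i") auto
    then have v0: "v = (\<lambda>_. 0)" using R v_l2 by (auto simp: solvable_rows_def)
    have u0: "u j = 0" if "j \<noteq> i" for j
      using v_eq[of j] v0 off[of j] injD[OF inj, of j i] that by auto
    have "pairing (\<lambda>l. phi (w - node \<alpha> (m, l))) (\<lambda>l. u (m, l))
        = pairing (unit_seq k) (\<lambda>l. phi (w - node \<alpha> (m, l)))"
    proof -
      have "(\<lambda>l. u (m, l)) = unit_seq k" using u0 ui by (auto simp: unit_seq_def i)
      then show ?thesis by (simp add: pairing_commute)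
    qed
    then have "phi (w - node \<alpha> i) = 0" using F0[of m] by (simp add: pairing_unit_left i)
    moreover have "exp (w - node \<alpha> i) \<noteq> 1"
      unfolding exp_diff_node by (rule exp_ne_1_off_nodes[OF off])
    ultimately show False using phi_nonzero by blast
  qed
qed

text \<open>The coefficients of the row vector \<open>d^*\<close> with respect to the rows of the inverse of \<open>W\<close>.\<close>

definition coords :: "complex^'n^'n \<Rightarrow> complex^'n \<Rightarrow> complex^'n" where
  "coords W d = vec_cnj d v* W"

lemma coords_nth: "coords W d $ p = (\<Sum>q\<in>UNIV. cnj (d $ q) * W $ q $ p)"
  by (simp add: coords_def vector_matrix_mult_def vec_cnj_def mult.commute)

text \<open>The vectors \<open>d\<close> excluded by the inequality form a hyperplane, and some coordinate direction leaves it.\<close>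

lemma exists_nearby_nonorthogonal:
  fixes W :: "complex^'n^'n"
  assumes W: "invertible W" and F: "F p0 \<noteq> 0" and \<eta>: "\<eta> > 0"
  obtains d where "d = dhat \<or> norm (d - dhat) = \<eta>" "(\<Sum>p\<in>UNIV. coords W d $ p * F p) \<noteq> 0"
proof -
  define G where "G q = (\<Sum>p\<in>UNIV. W $ q $ p * F p)" for q
  have pair: "(\<Sum>p\<in>UNIV. coords W d $ p * F p) = (\<Sum>q\<in>UNIV. cnj (d $ q) * G q)" for d
  proof -
    have "(\<Sum>p\<in>UNIV. coords W d $ p * F p) = (\<Sum>p\<in>UNIV. \<Sum>q\<in>UNIV. cnj (d $ q) * W $ q $ p * F p)"
      by (simp add: coords_nth sum_distrib_right)
    also have "\<dots> = (\<Sum>q\<in>UNIV. \<Sum>p\<in>UNIV. cnj (d $ q) * W $ q $ p * F p)" by (rule sum.swap)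
    finally show ?thesis by (simp add: G_def sum_distrib_left mult.assoc)
  qed
  have "\<exists>q. G q \<noteq> 0"
  proof (rule ccontr)
    assume "\<not> ?thesis"
    then have "W *v (\<chi> p. F p) = 0" by (simp add: matrix_vector_mult_def G_def vec_eq_iff)
    moreover obtain V where "V ** W = mat 1" using W by (auto simp: invertible_left_inverse)
    ultimately have "(\<chi> p. F p) = 0"
      by (metis matrix_vector_mul_assoc matrix_vector_mul_lid matrix_vector_mult_0_right)
    then show False using F by (simp add: vec_eq_iff)
  qed
  then obtain q where q: "G q \<noteq> 0" by blast
  show ?thesis
  proof (cases "(\<Sum>q\<in>UNIV. cnj (dhat $ q) * G q) = 0")
    case False then show ?thesis using that[of dhat] by (simp add: pair)
  next
    case True
    define d where "d = dhat + axis q (of_real \<eta>)"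
    have "(\<Sum>r\<in>UNIV. cnj (d $ r) * G r)
        = (\<Sum>r\<in>UNIV. cnj (dhat $ r) * G r) + (\<Sum>r\<in>UNIV. if r = q then of_real \<eta> * G r else 0)"
      unfolding sum.distrib[symmetric] by (intro sum.cong) (auto simp: d_def axis_def algebra_simps)
    then have "(\<Sum>r\<in>UNIV. cnj (d $ r) * G r) \<noteq> 0" using True q \<eta> by simp
    moreover have "norm (d - dhat) = \<eta>"
    proof -
      have "norm (axis q (of_real \<eta>) :: complex^'n) = sqrt (\<Sum>r\<in>UNIV. if r = q then \<eta>\<^sup>2 else 0)"
        unfolding norm_vec_def L2_set_def
        by (intro arg_cong[where f = sqrt] sum.cong) (auto simp: axis_def)
      then show ?thesis using \<eta> by (simp add: d_def)
    qed
    ultimately show ?thesis using that[of d] by (simp add: pair)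
  qed
qed

text \<open>Beyond some \<open>N\<close> the rows are so close to unit rows that replacing the others by unit rows yields a solvable system;
the induction then exchanges the finitely many rows with indices in \<open>H\<close>. The bound \<open>N\<close> is found before the size
\<open>\<eta>\<close> of the perturbations is given, so that a bound on their square sum can be met by the choice of \<open>\<eta>\<close>.\<close>

theorem solvable_moment_rows:
  fixes \<alpha> :: "'n::finite \<Rightarrow> complex" and W :: "complex^'n^'n"
    and lam :: "'n \<times> int \<Rightarrow> complex" and dhat :: "'n \<times> int \<Rightarrow> complex^'n"
  assumes inj: "inj (node \<alpha>)" and lam: "inj lam" and cross: "\<And>i j. lam i = node \<alpha> j \<Longrightarrow> j = i"
    and W: "invertible W"
    and near: "(\<lambda>i. (norm (coords W (dhat i) - axis (fst i) 1) + cmod (lam i - node \<alpha> i))\<^sup>2) summable_on UNIV"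
  obtains N :: nat where "\<And>\<eta>. \<eta> > 0 \<Longrightarrow> \<exists>d. (\<forall>m k. \<bar>k\<bar> > int N \<longrightarrow> d (m, k) = dhat (m, k))
      \<and> (\<forall>i. d i = dhat i \<or> norm (d i - dhat i) = \<eta>)
      \<and> solvable_rows (\<lambda>i. moment_row \<alpha> (coords W (d i)) (lam i))"
proof -
  define dev where "dev i = norm (coords W (dhat i) - axis (fst i) 1) + cmod (lam i - node \<alpha> i)" for i
  define A where "A = (\<Sum>p\<in>UNIV. cmod (\<alpha> p))"
  define D where "D = sqrt (\<Sum>\<^sub>\<infinity>i. (dev i)\<^sup>2)"
  define C where "C = sqrt (real CARD('n)) * exp (2 * A + D)"
  have dev_sum: "(\<lambda>i. (dev i)\<^sup>2) summable_on UNIV" using near by (simp add: dev_def)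
  have A: "cmod (\<alpha> p) \<le> A" for p unfolding A_def by (rule member_le_sum) auto
  have D: "cmod (lam i - node \<alpha> i) \<le> D" for i
  proof -
    have "cmod (lam i - node \<alpha> i) \<le> dev i" by (simp add: dev_def)
    also have "\<dots> \<le> D" unfolding D_def by (rule le_sqrt_infsum_squares[OF dev_sum])
    finally show ?thesis .
  qed
  have "(\<lambda>i. C\<^sup>2 * (dev i)\<^sup>2) summable_on UNIV" by (intro summable_on_cmult_right dev_sum)
  from small_tail[OF this, of "1/2"] obtain X where X: "finite X"
    "\<And>H. X \<subseteq> H \<Longrightarrow> (\<lambda>i. if i \<in> H then 0 else C\<^sup>2 * (dev i)\<^sup>2) summable_on UNIV
       \<and> (\<Sum>\<^sub>\<infinity>i. if i \<in> H then 0 else C\<^sup>2 * (dev i)\<^sup>2) \<le> 1/2"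
    by auto
  define N where "N = (\<Sum>i\<in>X. nat \<bar>snd i\<bar>)"
  define H :: "('n \<times> int) set" where "H = UNIV \<times> {- int N..int N}"
  have "finite H" by (simp add: H_def)
  have XH: "X \<subseteq> H"
  proof
    fix i assume "i \<in> X"
    then have "nat \<bar>snd i\<bar> \<le> N" unfolding N_def using X(1) by (intro member_le_sum) auto
    then show "i \<in> H" by (cases i) (auto simp: H_def)
  qed
  define row where "row d i = moment_row \<alpha> (coords W d) (lam i)" for d i
  define base where "base = (\<lambda>i. if i \<in> H then unit_seq i else row (dhat i) i)"
  have base: "solvable_rows base"
  proof -
    define K where "K i = (\<lambda>j. base i j - unit_seq i j)" for i
    have K_le: "(l2norm (K i))\<^sup>2 \<le> (if i \<in> H then 0 else C\<^sup>2 * (dev i)\<^sup>2)" for i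
    proof (cases "i \<in> H")
      case True
      then have "K i = (\<lambda>_. 0)" by (simp add: K_def base_def)
      then show ?thesis using True by (simp add: l2norm_def)
    next
      case False
      have "l2norm (K i) \<le> C * dev i"
        using moment_row_near_unit[of \<alpha> A "lam i" "fst i" "snd i" D "coords W (dhat i)"] A D[of i] False
        by (simp add: K_def base_def row_def C_def dev_def)
      then have "(l2norm (K i))\<^sup>2 \<le> (C * dev i)\<^sup>2" by (intro power_mono) auto
      then show ?thesis using False by (simp add: power_mult_distrib)
    qed
    have sm: "(\<lambda>i. (l2norm (K i))\<^sup>2) summable_on UNIV"
      by (rule nonneg_summable_dominated[OF conjunct1[OF X(2)[OF XH]]]) (auto simp: K_le)
    have "(\<Sum>\<^sub>\<infinity>i. (l2norm (K i))\<^sup>2) \<le> (\<Sum>\<^sub>\<infinity>i. if i \<in> H then 0 else C\<^sup>2 * (dev i)\<^sup>2)"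
      by (rule infsum_mono[OF sm conjunct1[OF X(2)[OF XH]] K_le])
    also have "\<dots> \<le> 1/2" using X(2)[OF XH] by blast
    finally have less: "(\<Sum>\<^sub>\<infinity>i. (l2norm (K i))\<^sup>2) < 1" by simp
    have "K i \<in> l2" for i
      unfolding K_def base_def row_def by (intro l2_diff unit_seq_l2) (simp add: moment_row_l2)
    from solvable_rows_near_identity[OF this sm less] show ?thesis by (simp add: K_def)
  qed
  have step: "\<exists>d. (\<forall>i. i \<notin> S \<longrightarrow> d i = dhat i) \<and> (\<forall>i. d i = dhat i \<or> norm (d i - dhat i) = \<eta>)
      \<and> solvable_rows (\<lambda>i. if i \<in> H - S then unit_seq i else row (d i) i)"
    if \<eta>: "\<eta> > 0" and S: "finite S" "S \<subseteq> H" for S \<eta>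
    using S
  proof (induction S rule: finite_induct)
    case empty
    then show ?case using base by (auto simp: base_def)
  next
    case (insert i S)
    then obtain d where d: "\<And>j. j \<notin> S \<Longrightarrow> d j = dhat j" "\<And>j. d j = dhat j \<or> norm (d j - dhat j) = \<eta>"
      and R: "solvable_rows (\<lambda>j. if j \<in> H - S then unit_seq j else row (d j) j)" by auto
    define R where "R = (\<lambda>j. if j \<in> H - S then unit_seq j else row (d j) j)"
    have R_solv: "solvable_rows R" using R by (simp add: R_def)
    obtain u where u: "u \<in> l2" "\<And>j. pairing (R j) u = unit_seq i j"
      using R_solv unit_seq_l2[of i] unfolding solvable_rows_def by blast
    define F where "F p = pairing (\<lambda>l. phi (lam i - node \<alpha> (p, l))) (\<lambda>l. u (p, l))" for p
    have "\<exists>p. F p \<noteq> 0" unfolding F_def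
    proof (rule transform_nonzero_at_new_node[OF inj R_solv u])
      show "R i = unit_seq i" using insert by (simp add: R_def)
      show "R j = unit_seq j \<or> (\<exists>y s. s \<noteq> lam i \<and> R j = moment_row \<alpha> y s)" if "j \<noteq> i" for j
        using injD[OF lam, of j i] that by (auto simp: R_def row_def)
      show "j = i" if "lam i = node \<alpha> j" for j using cross that .
    qed
    then obtain p0 where p0: "F p0 \<noteq> 0" by blast
    obtain e where e: "e = dhat i \<or> norm (e - dhat i) = \<eta>" "(\<Sum>p\<in>UNIV. coords W e $ p * F p) \<noteq> 0"
      using exists_nearby_nonorthogonal[of W F p0 \<eta> "dhat i"] W p0 \<eta> by blast
    have "pairing (row e i) u \<noteq> 0"
      using e(2) by (simp add: row_def pairing_moment_row[OF u(1)] F_def)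
    then have "solvable_rows (R(i := row e i))"
      by (intro solvable_rows_exchange[OF R_solv u]) (simp_all add: row_def moment_row_l2)
    moreover have "R(i := row e i) = (\<lambda>j. if j \<in> H - insert i S then unit_seq j else row ((d(i := e)) j) j)"
      by (auto simp: R_def fun_eq_iff)
    ultimately show ?case using d e(1) by (intro exI[of _ "d(i := e)"]) auto
  qed
  show ?thesis
  proof (rule that[of N])
    fix \<eta> :: real assume \<eta>: "\<eta> > 0"
    have outside: "(m, k) \<notin> H" if "\<bar>k\<bar> > int N" for m k using that by (auto simp: H_def)
    from step[OF \<eta> \<open>finite H\<close> subset_refl]
    obtain d where "\<forall>i. i \<notin> H \<longrightarrow> d i = dhat i" "\<forall>i. d i = dhat i \<or> norm (d i - dhat i) = \<eta>"
      "solvable_rows (\<lambda>i. row (d i) i)" by auto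
    then show "\<exists>d. (\<forall>m k. \<bar>k\<bar> > int N \<longrightarrow> d (m, k) = dhat (m, k))
      \<and> (\<forall>i. d i = dhat i \<or> norm (d i - dhat i) = \<eta>)
      \<and> solvable_rows (\<lambda>i. moment_row \<alpha> (coords W (d i)) (lam i))"
      by (intro exI[of _ d]) (auto simp: row_def outside)
  qed
qed

section \<open>The characteristic matrix\<close>

lemma log_branch_node: "log_branch (\<mu> p) l = node (\<lambda>q. log_branch (\<mu> q) 0) (p, l)"
  by (simp add: log_branch_def node_def freq_def algebra_simps)

lemma exp_log_branch_0: "z \<noteq> 0 \<Longrightarrow> exp (log_branch z 0) = z"
  using Arg_eq[of z] by (simp add: log_branch_def exp_add exp_of_real)

lemma exp_node: "exp (node \<alpha> (p, l)) = exp (\<alpha> p)"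
  by (simp add: node_def exp_add)

lemma inj_node:
  assumes "inj (\<lambda>p. exp (\<alpha> p))" shows "inj (node \<alpha>)"
proof (rule injI)
  fix i j assume eq: "node \<alpha> i = node \<alpha> j"
  obtain p l p' l' where ij: "i = (p, l)" "j = (p', l')" by (cases i, cases j)
  have "exp (\<alpha> p) = exp (\<alpha> p')" using arg_cong[OF eq, of exp] by (simp add: ij exp_node)
  then have "p = p'" using injD[OF assms, of p p'] by simp
  moreover from this have "freq (l - l') = 0" using eq by (simp add: ij node_def flip: freq_diff)
  ultimately show "i = j" by (simp add: ij)
qed

lemma norm_coords_le:
  fixes W :: "complex^'n^'n"
  shows "norm (coords W x) \<le> (\<Sum>p\<in>UNIV. \<Sum>q\<in>UNIV. cmod (W $ q $ p)) * norm x"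
proof -
  have "norm (coords W x) \<le> (\<Sum>p\<in>UNIV. cmod (coords W x $ p))" 
    unfolding norm_vec_def by (rule L2_set_le_sum) auto
  also have "\<dots> \<le> (\<Sum>p\<in>UNIV. \<Sum>q\<in>UNIV. cmod (W $ q $ p) * norm x)"
  proof (rule sum_mono)
    fix p
    have "cmod (coords W x $ p) \<le> (\<Sum>q\<in>UNIV. cmod (cnj (x $ q) * W $ q $ p))"
      unfolding coords_nth by (rule norm_sum)
    also have "\<dots> \<le> (\<Sum>q\<in>UNIV. cmod (W $ q $ p) * norm x)"
    proof (rule sum_mono)
      fix q
      show "cmod (cnj (x $ q) * W $ q $ p) \<le> cmod (W $ q $ p) * norm x"
        using Finite_Cartesian_Product.norm_nth_le[of x q] by (simp add: norm_mult mult.commute mult_right_mono)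
    qed
    finally show "cmod (coords W x $ p) \<le> (\<Sum>q\<in>UNIV. cmod (W $ q $ p) * norm x)" .
  qed
  also have "\<dots> = (\<Sum>p\<in>UNIV. \<Sum>q\<in>UNIV. cmod (W $ q $ p)) * norm x" by (simp add: sum_distrib_right)
  finally show ?thesis .
qed

lemma coords_diff: "coords W (x - y) = coords W x - coords W y"
  by (simp add: vec_eq_iff coords_nth sum_subtractf algebra_simps)

text \<open>In coordinates these are the right-hand sides \<open>d^* (I - e^(-\<lambda>) A1)\<close> of the moment problem. In component \<open>p = fst i\<close>
the factor \<open>1 - exp (\<alpha> p - lam i)\<close> is small since \<open>lam i\<close> is close to a logarithm of \<open>exp (\<alpha> p)\<close>; in the other
components \<open>y i $ p\<close> is small.\<close>

lemma near_unit_rhs_l2: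
  fixes \<alpha> :: "'n::finite \<Rightarrow> complex" and y :: "'n \<times> int \<Rightarrow> complex^'n" and lam :: "'n \<times> int \<Rightarrow> complex"
  assumes near: "(\<lambda>i. (norm (y i - axis (fst i) 1) + cmod (lam i - node \<alpha> i))\<^sup>2) summable_on UNIV"
  shows "(\<lambda>i. y i $ p * (1 - exp (\<alpha> p - lam i))) \<in> l2"
proof -
  define dev where "dev i = norm (y i - axis (fst i) 1) + cmod (lam i - node \<alpha> i)" for i :: "'n \<times> int"
  define A where "A = (\<Sum>p\<in>UNIV. cmod (\<alpha> p))"
  define D where "D = sqrt (\<Sum>\<^sub>\<infinity>i. (dev i)\<^sup>2)"
  define E where "E = 1 + exp (2 * A + D)"
  have dev_sum: "(\<lambda>i. (dev i)\<^sup>2) summable_on UNIV" using near by (simp add: dev_def)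
  have A: "cmod (\<alpha> p) \<le> A" for p unfolding A_def by (rule member_le_sum) auto
  have A0: "0 \<le> A" by (simp add: A_def sum_nonneg)
  have D: "cmod (lam i - node \<alpha> i) \<le> D" for i
  proof -
    have "cmod (lam i - node \<alpha> i) \<le> dev i" by (simp add: dev_def)
    also have "\<dots> \<le> D" unfolding D_def by (rule le_sqrt_infsum_squares[OF dev_sum])
    finally show ?thesis .
  qed
  show ?thesis
  proof (rule l2_dominated(1)[OF dev_sum])
    show "0 \<le> E" by (simp add: E_def add_nonneg_nonneg)
    fix i :: "'n \<times> int"
    obtain m k where i: "i = (m, k)" by (cases i)
    define d where "d = lam i - node \<alpha> i"
    let ?x = "1 - exp (\<alpha> p - lam i)"
    have ex: "exp (\<alpha> p - lam i) = exp (\<alpha> p - \<alpha> m - d)"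
    proof -
      have e: "\<alpha> p - lam i = \<alpha> p - \<alpha> m - d + freq (- k)" by (simp add: d_def i node_def flip: freq_minus)
      show ?thesis unfolding e exp_add exp_freq by simp
    qed
    have xE: "cmod ?x \<le> E"
    proof -
      have "\<bar>Re (\<alpha> p - \<alpha> m - d)\<bar> \<le> 2 * A + D"
        using abs_Re_le_cmod[of "\<alpha> m"] abs_Re_le_cmod[of "\<alpha> p"] abs_Re_le_cmod[of d] A[of m] A[of p] D[of i]
        unfolding d_def minus_complex.sel by linarith
      then have le: "cmod (exp (\<alpha> p - \<alpha> m - d)) \<le> exp (2 * A + D)" by simp
      have "cmod ?x \<le> cmod 1 + cmod (exp (\<alpha> p - \<alpha> m - d))" unfolding ex by (rule norm_triangle_ineq4)
      also have "\<dots> \<le> E" unfolding E_def norm_one by (rule add_left_mono[OF le])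
      finally show ?thesis .
    qed
    have x_diag: "cmod ?x \<le> cmod d * E" if "p = m"
    proof -
      have "cmod ?x = cmod (exp (- d) - 1)" unfolding ex by (simp add: that norm_minus_commute)
      also have "\<dots> \<le> cmod d * exp (cmod d)" using norm_exp_minus_1_le[of "- d"] by simp
      also have "\<dots> \<le> cmod d * E"
      proof (rule mult_left_mono)
        have "exp (cmod d) \<le> exp (2 * A + D)" using D[of i] A0 by (simp add: d_def)
        then show "exp (cmod d) \<le> E" unfolding E_def by linarith
      qed simp
      finally show ?thesis .
    qed
    have "y i $ p * ?x = (y i - axis m 1) $ p * ?x + axis m 1 $ p * ?x" by (simp add: algebra_simps)
    then have "cmod (y i $ p * ?x) \<le> cmod ((y i - axis m 1) $ p) * cmod ?x + cmod (axis m 1 $ p * ?x)"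
      by (metis norm_mult norm_triangle_ineq)
    also have "\<dots> \<le> norm (y i - axis m 1) * E + cmod d * E"
    proof (rule add_mono)
      show "cmod ((y i - axis m 1) $ p) * cmod ?x \<le> norm (y i - axis m 1) * E"
        by (intro mult_mono Finite_Cartesian_Product.norm_nth_le xE) auto
      show "cmod (axis m 1 $ p * ?x) \<le> cmod d * E"
        using x_diag by (cases "p = m") (auto simp: axis_def E_def intro!: mult_nonneg_nonneg add_nonneg_nonneg)
    qed
    also have "\<dots> = E * dev i" by (simp add: dev_def d_def i algebra_simps)
    finally show "cmod (y i $ p * ?x) \<le> E * dev i" .
  qed
qed

lemma det_zero_if_left_kernel:
  fixes M :: "complex^'n^'n"
  assumes "v v* M = 0" "v \<noteq> 0" shows "det M = 0"
proof (rule ccontr)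
  assume "det M \<noteq> 0"
  then obtain B where "M ** B = mat 1" using invertible_det_nz invertible_right_inverse by blast
  then have "v = (v v* M) v* B" by (simp add: vector_matrix_mul_assoc)
  also have "\<dots> = 0" unfolding assms(1) by (simp add: vector_matrix_mult_def vec_eq_iff)
  finally show False using assms(2) by simp
qed

lemma scalar_matrix_nth [simp]: "(mat c ** A) $ i $ j = c * A $ i $ j"
proof -
  have "(mat c ** A) $ i $ j = (\<Sum>k\<in>UNIV. if k = i then c * A $ k $ j else 0)"
    unfolding matrix_matrix_mult_def mat_def vec_lambda_beta by (intro sum.cong) auto
  then show ?thesis by simp
qed

lemma square_integrable_sum:
  assumes fin: "finite P" and meas: "\<And>p. p \<in> P \<Longrightarrow> g p \<in> borel_measurable unit_ivl"
    and sq: "\<And>p. p \<in> P \<Longrightarrow> integrable unit_ivl (\<lambda>\<theta>. (cmod (g p \<theta>))\<^sup>2)"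
    and b: "\<And>p. p \<in> P \<Longrightarrow> continuous_on {-1..0} (b p)"
  shows "(\<lambda>\<theta>. \<Sum>p\<in>P. b p \<theta> * g p \<theta>) \<in> borel_measurable unit_ivl"
    "integrable unit_ivl (\<lambda>\<theta>. (cmod (\<Sum>p\<in>P. b p \<theta> * g p \<theta>))\<^sup>2)"
proof -
  have bm: "b p \<in> borel_measurable unit_ivl" if "p \<in> P" for p
    by (intro borel_measurable_integrable continuous_imp_integrable_real b that)
  show M: "(\<lambda>\<theta>. \<Sum>p\<in>P. b p \<theta> * g p \<theta>) \<in> borel_measurable unit_ivl"
    by (intro borel_measurable_sum borel_measurable_times meas bm)
  have "\<exists>B. \<forall>\<theta>\<in>{-1..0}. cmod (b p \<theta>) \<le> B" if "p \<in> P" for p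
    using compact_imp_bounded[OF compact_continuous_image[OF b[OF that] compact_Icc]]
    by (auto simp: bounded_iff)
  then obtain B where B: "\<And>p \<theta>. p \<in> P \<Longrightarrow> \<theta> \<in> {-1..0} \<Longrightarrow> cmod (b p \<theta>) \<le> B p" by metis
  let ?G = "\<lambda>\<theta>. (\<Sum>p\<in>P. (B p)\<^sup>2 * (cmod (g p \<theta>))\<^sup>2) * card P"
  show "integrable unit_ivl (\<lambda>\<theta>. (cmod (\<Sum>p\<in>P. b p \<theta> * g p \<theta>))\<^sup>2)"
  proof (rule Bochner_Integration.integrable_bound)
    show "integrable unit_ivl ?G"
      by (intro integrable_mult_left Bochner_Integration.integrable_sum integrable_mult_right sq)
    show "(\<lambda>\<theta>. (cmod (\<Sum>p\<in>P. b p \<theta> * g p \<theta>))\<^sup>2) \<in> borel_measurable unit_ivl"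
      using M by measurable
    show "AE \<theta> in unit_ivl. norm ((cmod (\<Sum>p\<in>P. b p \<theta> * g p \<theta>))\<^sup>2) \<le> norm (?G \<theta>)"
    proof (rule AE_I2)
      fix \<theta> assume "\<theta> \<in> space unit_ivl"
      then have t: "\<theta> \<in> {-1..0}" by (simp add: space_restrict_space)
      have "(cmod (\<Sum>p\<in>P. b p \<theta> * g p \<theta>))\<^sup>2 \<le> (\<Sum>p\<in>P. cmod (b p \<theta> * g p \<theta>))\<^sup>2"
        by (intro power_mono norm_sum) auto
      also have "\<dots> \<le> (\<Sum>p\<in>P. (cmod (b p \<theta> * g p \<theta>))\<^sup>2) * card P" by (rule sum_squared_le_sum_of_squares)
      also have "\<dots> \<le> ?G \<theta>"
        by (intro mult_right_mono sum_mono)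
           (auto simp: norm_mult power_mult_distrib intro!: mult_right_mono power_mono B t)
      also have "\<dots> \<le> norm (?G \<theta>)" by simp
      finally show "norm ((cmod (\<Sum>p\<in>P. b p \<theta> * g p \<theta>))\<^sup>2) \<le> norm (?G \<theta>)" by simp
    qed
  qed
qed

text \<open>The entries \<open>f q\<close> are sums over \<open>p\<close> of the Fourier series with coefficients \<open>a (p, l)\<close>, twisted by
\<open>exp (- \<alpha> p \<theta>)\<close> and weighted with \<open>W $ q $ p\<close>, so that contraction with \<open>d^*\<close> produces the coordinates of \<open>d\<close>.\<close>

theorem moment_problem:
  fixes \<alpha> :: "'n::finite \<Rightarrow> complex" and W :: "complex^'n^'n"
  assumes a: "a \<in> l2"
  obtains f :: "'n \<Rightarrow> real \<Rightarrow> complex" where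
    "\<And>q. f q \<in> borel_measurable unit_ivl" "\<And>q. integrable unit_ivl (\<lambda>\<theta>. (cmod (f q \<theta>))\<^sup>2)"
    "\<And>d s. (\<Sum>q\<in>UNIV. vec_cnj d $ q * (LINT \<theta>|unit_ivl. exp (s * of_real \<theta>) * f q \<theta>))
        = pairing (moment_row \<alpha> (coords W d) s) a"
proof -
  have "\<exists>g. g \<in> borel_measurable unit_ivl \<and> integrable unit_ivl (\<lambda>\<theta>. (cmod (g \<theta>))\<^sup>2) \<and>
    (\<forall>s. integrable unit_ivl (\<lambda>\<theta>. exp (s * of_real \<theta>) * g \<theta>)) \<and>
    (\<forall>s. (LINT \<theta>|unit_ivl. exp (s * of_real \<theta>) * g \<theta>) = pairing (\<lambda>l. phi (s - freq l)) (\<lambda>l. a (p, l)))" for p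
  proof -
    obtain g where "g \<in> borel_measurable unit_ivl" "integrable unit_ivl (\<lambda>\<theta>. (cmod (g \<theta>))\<^sup>2)"
      "\<And>s. integrable unit_ivl (\<lambda>\<theta>. exp (s * of_real \<theta>) * g \<theta>)"
      "\<And>s. (LINT \<theta>|unit_ivl. exp (s * of_real \<theta>) * g \<theta>) = pairing (\<lambda>l. phi (s - freq l)) (\<lambda>l. a (p, l))"
      by (rule Riesz_Fischer[OF l2_slice[OF a, of p]]) (rule that)
    then show ?thesis by (intro exI[of _ g]) simp
  qed
  from choice[OF allI[OF this]] obtain g where "\<forall>p. g p \<in> borel_measurable unit_ivl \<and>
    integrable unit_ivl (\<lambda>\<theta>. (cmod (g p \<theta>))\<^sup>2) \<and>
    (\<forall>s. integrable unit_ivl (\<lambda>\<theta>. exp (s * of_real \<theta>) * g p \<theta>)) \<and>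
    (\<forall>s. (LINT \<theta>|unit_ivl. exp (s * of_real \<theta>) * g p \<theta>) = pairing (\<lambda>l. phi (s - freq l)) (\<lambda>l. a (p, l)))" ..
  then have g: "g p \<in> borel_measurable unit_ivl"
      "integrable unit_ivl (\<lambda>\<theta>. (cmod (g p \<theta>))\<^sup>2)"
      "integrable unit_ivl (\<lambda>\<theta>. exp (s * of_real \<theta>) * g p \<theta>)"
      "(LINT \<theta>|unit_ivl. exp (s * of_real \<theta>) * g p \<theta>) = pairing (\<lambda>l. phi (s - freq l)) (\<lambda>l. a (p, l))" for p s
    by simp_all
  define f where "f q \<theta> = (\<Sum>p\<in>UNIV. W $ q $ p * exp (- \<alpha> p * of_real \<theta>) * g p \<theta>)" for q and \<theta> :: real
  let ?P = "\<lambda>s p. pairing (\<lambda>l. phi (s - node \<alpha> (p, l))) (\<lambda>l. a (p, l))"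
  have moment: "(LINT \<theta>|unit_ivl. exp (s * of_real \<theta>) * f q \<theta>) = (\<Sum>p\<in>UNIV. W $ q $ p * ?P s p)" for s q
  proof -
    have "exp (s * of_real \<theta>) * f q \<theta> = (\<Sum>p\<in>UNIV. W $ q $ p * (exp ((s - \<alpha> p) * of_real \<theta>) * g p \<theta>))" for \<theta>
    proof -
      have "exp ((s - \<alpha> p) * of_real \<theta>) = exp (s * of_real \<theta>) * exp (- \<alpha> p * of_real \<theta>)" for p
        unfolding exp_add[symmetric] by (rule arg_cong[where f = exp]) (simp add: algebra_simps)
      then show ?thesis unfolding f_def sum_distrib_left by (intro sum.cong refl) (simp only: mult_ac)
    qed
    then have "(LINT \<theta>|unit_ivl. exp (s * of_real \<theta>) * f q \<theta>)
        = (\<Sum>p\<in>UNIV. W $ q $ p * (LINT \<theta>|unit_ivl. exp ((s - \<alpha> p) * of_real \<theta>) * g p \<theta>))"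
      by (simp add: g(3))
    then show ?thesis by (simp add: g(4) node_def diff_diff_eq)
  qed
  show ?thesis
  proof (rule that[of f])
    have c: "continuous_on {-1..0} (\<lambda>\<theta>. W $ q $ p * exp (- \<alpha> p * of_real \<theta>))" for q p
      by (intro continuous_intros)
    show "f q \<in> borel_measurable unit_ivl" "integrable unit_ivl (\<lambda>\<theta>. (cmod (f q \<theta>))\<^sup>2)" for q
      unfolding f_def[abs_def]
      using square_integrable_sum[of UNIV g "\<lambda>p \<theta>. W $ q $ p * exp (- \<alpha> p * of_real \<theta>)"] g(1,2) c by auto
    fix d s
    have "(\<Sum>q\<in>UNIV. vec_cnj d $ q * (\<Sum>p\<in>UNIV. W $ q $ p * ?P s p))
       = (\<Sum>q\<in>UNIV. \<Sum>p\<in>UNIV. cnj (d $ q) * W $ q $ p * ?P s p)"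
      by (simp add: vec_cnj_def sum_distrib_left mult.assoc)
    also have "\<dots> = (\<Sum>p\<in>UNIV. \<Sum>q\<in>UNIV. cnj (d $ q) * W $ q $ p * ?P s p)" by (rule sum.swap)
    also have "\<dots> = pairing (moment_row \<alpha> (coords W d) s) a"
      by (simp add: pairing_moment_row[OF a] coords_nth sum_distrib_right)
    finally show "(\<Sum>q\<in>UNIV. vec_cnj d $ q * (LINT \<theta>|unit_ivl. exp (s * of_real \<theta>) * f q \<theta>))
        = pairing (moment_row \<alpha> (coords W d) s) a" by (simp add: moment)
  qed
qed

text \<open>Without the last integral the matrix has the factor \<open>w\<close>; in particular it vanishes at \<open>w = 0\<close>, so a zero among the
prescribed points needs no separate treatment.\<close>

lemma left_mult_char_matrix:
  fixes A2 :: "real \<Rightarrow> complex^'n^'n"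
  shows "(v v* char_matrix A1 A2 (\<lambda>_. 0) w) $ j
    = w * (v $ j - exp (- w) * (v v* A1) $ j
        - (\<Sum>q\<in>UNIV. v $ q * (LINT \<theta>|unit_ivl. exp (w * of_real \<theta>) * A2 \<theta> $ q $ j)))"
proof -
  have entry: "char_matrix A1 A2 (\<lambda>_. 0) w $ q $ j
      = w * ((if q = j then 1 else 0) - exp (- w) * A1 $ q $ j
          - (LINT \<theta>|unit_ivl. exp (w * of_real \<theta>) * A2 \<theta> $ q $ j))" for q
  proof -
    have "(LINT \<theta>|unit_ivl. w * exp (w * of_real \<theta>) * A2 \<theta> $ q $ j)
        = w * (LINT \<theta>|unit_ivl. exp (w * of_real \<theta>) * A2 \<theta> $ q $ j)"
      by (simp add: mult.assoc)
    moreover have "(mat w :: complex^'n^'n) $ q $ j = (if q = j then w else 0)" by (simp add: mat_def)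
    ultimately show ?thesis
      by (simp add: char_matrix_def matrix_integral_def algebra_simps)
  qed
  have "(v v* char_matrix A1 A2 (\<lambda>_. 0) w) $ j
    = (\<Sum>q\<in>UNIV. w * ((if q = j then v $ q else 0) - exp (- w) * (v $ q * A1 $ q $ j)
        - v $ q * (LINT \<theta>|unit_ivl. exp (w * of_real \<theta>) * A2 \<theta> $ q $ j)))"
    unfolding vector_matrix_mult_def vec_lambda_beta entry by (intro sum.cong) (auto simp: algebra_simps)
  also have "\<dots> = w * (v $ j - exp (- w) * (v v* A1) $ j
        - (\<Sum>q\<in>UNIV. v $ q * (LINT \<theta>|unit_ivl. exp (w * of_real \<theta>) * A2 \<theta> $ q $ j)))"
    unfolding vector_matrix_mult_def
    by (simp add: sum_distrib_left[symmetric] sum_subtractf mult.commute)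
  finally show ?thesis .
qed

theorem theorem5p7:
  fixes \<mu> :: "'n::finite \<Rightarrow> complex"
    and z :: "'n \<Rightarrow> complex^'n"
    and lam :: "'n \<Rightarrow> int \<Rightarrow> complex"
    and dhat :: "'n \<Rightarrow> int \<Rightarrow> complex^'n"
    and \<epsilon> :: real
  assumes "inj \<mu>" and "\<And>m. \<mu> m \<noteq> 0"
    and "\<And>m. z m \<noteq> 0" and "inj z" and "vec.independent (range z)"
    and "\<And>m k m' k'. lam m k = lam m' k' \<Longrightarrow> m = m' \<and> k = k'"
    and "\<And>m. (\<lambda>k. (cmod (lam m k - log_branch (\<mu> m) k))\<^sup>2) summable_on UNIV"
    and "\<And>m0 k0 m k. lam m0 k0 = log_branch (\<mu> m) k \<Longrightarrow> m0 = m \<and> k0 = k"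
    and "\<And>m. (\<lambda>k. (norm (dhat m k - z m))\<^sup>2) summable_on UNIV"
    and "\<epsilon> > 0"
  shows "\<exists>d :: 'n \<Rightarrow> int \<Rightarrow> complex^'n.
    (\<forall>m. (\<lambda>k. (norm (d m k - dhat m k))\<^sup>2) summable_on UNIV \<and>
         (\<Sum>\<^sub>\<infinity>k. (norm (d m k - dhat m k))\<^sup>2) < \<epsilon>) \<and>
    (\<exists>N::nat. \<forall>m k. \<bar>k\<bar> > int N \<longrightarrow> d m k = dhat m k) \<and>
    (\<exists>(A1 :: complex^'n^'n) A2 A3.
       L2_entries A2 \<and> L2_entries A3 \<and> matrix_integral A3 = 0 \<and>
       (\<forall>m k. det (char_matrix A1 A2 A3 (lam m k)) = 0) \<and>
       (\<forall>m k. vec_cnj (d m k) v* char_matrix A1 A2 A3 (lam m k) = 0))"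
proof -
  define \<alpha> where "\<alpha> p = log_branch (\<mu> p) 0" for p
  have exp_\<alpha>: "exp (\<alpha> p) = \<mu> p" for p using assms(2) by (simp add: \<alpha>_def exp_log_branch_0)
  have node: "log_branch (\<mu> p) l = node \<alpha> (p, l)" for p l
    unfolding \<alpha>_def by (rule log_branch_node)
  have inj_nodes: "inj (node \<alpha>)" by (rule inj_node) (simp add: exp_\<alpha> assms(1))

  define Z where "Z = (\<chi> m. vec_cnj (z m))"
  \<comment> \<open>Independence of the \<open>z m\<close> over the complex numbers passes to their conjugates, the rows of \<open>Z\<close>.\<close>
  obtain W where ZW: "Z ** W = mat 1"
  proof -
    have "\<forall>c. (\<Sum>i\<in>UNIV. c i *s row i Z) = 0 \<longrightarrow> (\<forall>i. c i = 0)"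
    proof (intro allI impI)
      fix c i assume c: "(\<Sum>i\<in>UNIV. c i *s row i Z) = 0"
      have "(\<Sum>m\<in>UNIV. cnj (c m) *s z m) = 0"
      proof (subst vec_eq_iff, intro allI)
        fix q
        have "cnj ((\<Sum>i\<in>UNIV. c i *s row i Z) $ q) = 0" using c by simp
        then show "(\<Sum>m\<in>UNIV. cnj (c m) *s z m) $ q = 0 $ q"
          by (simp add: Z_def row_def vec_cnj_def)
      qed
      moreover have "(\<Sum>m\<in>UNIV. cnj (c m) *s z m) = (\<Sum>v\<in>range z. cnj (c (inv z v)) *s v)"
        by (subst sum.reindex[OF assms(4)]) (simp add: assms(4))
      ultimately have "cnj (c (inv z v)) = 0" if "v \<in> range z" for v
        using vec.independentD[OF assms(5), of "range z" "\<lambda>v. cnj (c (inv z v))"] that by simp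
      from this[of "z i"] show "c i = 0" using assms(4) by simp
    qed
    then show ?thesis using that matrix_right_invertible_independent_rows[of Z] by blast
  qed
  have WZ: "W ** Z = mat 1" using ZW matrix_left_right_inverse by blast
  have W: "invertible W" using ZW by (auto simp: invertible_left_inverse)
  have coords_z: "coords W (z m) = axis m 1" for m
  proof (subst vec_eq_iff, intro allI)
    fix p
    have "coords W (z m) $ p = (Z ** W) $ m $ p"
      by (simp add: coords_nth matrix_matrix_mult_def Z_def vec_cnj_def)
    also have "\<dots> = axis m 1 $ p" unfolding ZW by (simp add: mat_def axis_def eq_commute)
    finally show "coords W (z m) $ p = axis m 1 $ p" .
  qed

  define lam' where "lam' = (\<lambda>(m, k). lam m k)"
  define dhat' where "dhat' = (\<lambda>(m, k). dhat m k)"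
  define B where "B = (\<Sum>p\<in>UNIV. \<Sum>q\<in>UNIV. cmod (W $ q $ p))"
  have near: "(\<lambda>i. (norm (coords W (dhat' i) - axis (fst i) 1) + cmod (lam' i - node \<alpha> i))\<^sup>2) summable_on UNIV"
  proof (rule nonneg_summable_dominated)
    let ?g = "\<lambda>i. 2 * B\<^sup>2 * (norm (dhat' i - z (fst i)))\<^sup>2 + 2 * (cmod (lam' i - node \<alpha> i))\<^sup>2"
    have "(\<lambda>k. ?g (m, k)) summable_on UNIV" for m
      unfolding dhat'_def lam'_def
      using assms(7)[of m] assms(9)[of m]
      by (intro summable_on_add summable_on_cmult_right) (simp_all add: node)
    from has_sum_imp_summable[OF has_sum_finite_product[OF this]] show "?g summable_on UNIV" .
    fix i :: "'n \<times> int"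
    have "norm (coords W (dhat' i) - axis (fst i) 1) \<le> B * norm (dhat' i - z (fst i))"
      unfolding coords_z[symmetric] coords_diff[symmetric] B_def by (rule norm_coords_le)
    then have "(norm (coords W (dhat' i) - axis (fst i) 1))\<^sup>2 \<le> (B * norm (dhat' i - z (fst i)))\<^sup>2"
      by (intro power_mono) auto
    moreover have "(x + y)\<^sup>2 \<le> 2 * x\<^sup>2 + 2 * y\<^sup>2" for x y :: real
      using sum_squares_bound[of x y] by (simp add: power2_sum)
    note this[of "norm (coords W (dhat' i) - axis (fst i) 1)" "cmod (lam' i - node \<alpha> i)"]
    ultimately show "(norm (coords W (dhat' i) - axis (fst i) 1) + cmod (lam' i - node \<alpha> i))\<^sup>2 \<le> ?g i"
      by (simp add: power_mult_distrib)
  qed simp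

  have inj_lam: "inj lam'" using assms(6) by (auto simp: lam'_def inj_on_def)
  have cross: "lam' i = node \<alpha> j \<Longrightarrow> j = i" for i j
    using assms(8) by (cases i, cases j) (auto simp: lam'_def node)
  obtain N :: nat where N: "\<And>\<eta>. \<eta> > 0 \<Longrightarrow> \<exists>d. (\<forall>m k. \<bar>k\<bar> > int N \<longrightarrow> d (m, k) = dhat' (m, k))
      \<and> (\<forall>i. d i = dhat' i \<or> norm (d i - dhat' i) = \<eta>)
      \<and> solvable_rows (\<lambda>i. moment_row \<alpha> (coords W (d i)) (lam' i))"
    using solvable_moment_rows[OF inj_nodes inj_lam cross W near] by blast
  \<comment> \<open>For each m at most c vectors are perturbed, and each contributes the square of \<eta> to the sum.\<close>
  define c where "c = 2 * real N + 1"
  define \<eta> where "\<eta> = sqrt (\<epsilon> / (2 * c))"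
  have c: "c > 0" by (simp add: c_def)
  then have pos: "\<epsilon> / (2 * c) > 0" using assms(10) by simp
  then have \<eta>: "\<eta> > 0" by (simp add: \<eta>_def)
  have "\<eta>\<^sup>2 = \<epsilon> / (2 * c)" using pos by (simp add: \<eta>_def)
  then have \<eta>_small: "c * \<eta>\<^sup>2 < \<epsilon>" using c assms(10) by simp
  obtain d' where d'_tail: "\<And>m k. \<bar>k\<bar> > int N \<Longrightarrow> d' (m, k) = dhat' (m, k)"
    and d'_near: "\<And>i. d' i = dhat' i \<or> norm (d' i - dhat' i) = \<eta>"
    and solv: "solvable_rows (\<lambda>i. moment_row \<alpha> (coords W (d' i)) (lam' i))"
    using N[OF \<eta>] by blast

  define A1 where "A1 = W ** (\<chi> i j. if i = j then \<mu> i else 0) ** Z"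
  have A1_row: "(vec_cnj v v* A1) $ j = (\<Sum>p\<in>UNIV. coords W v $ p * \<mu> p * Z $ p $ j)" for v j
  proof -
    let ?D = "(\<chi> i j. if i = j then \<mu> i else 0) :: complex^'n^'n"
    have "vec_cnj v v* A1 = (coords W v v* ?D) v* Z"
      unfolding A1_def coords_def by (simp add: vector_matrix_mul_assoc)
    moreover have "(coords W v v* ?D) $ p = coords W v $ p * \<mu> p" for p
    proof -
      have "(coords W v v* ?D) $ p = (\<Sum>q\<in>UNIV. if q = p then coords W v $ p * \<mu> p else 0)"
        unfolding vector_matrix_mult_def vec_lambda_beta by (intro sum.cong) auto
      then show ?thesis by simp
    qed
    ultimately show ?thesis by (simp add: vector_matrix_mult_def mult.commute)
  qed
  have v_row: "vec_cnj v $ j = (\<Sum>p\<in>UNIV. coords W v $ p * Z $ p $ j)" for v j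
  proof -
    have "vec_cnj v = coords W v v* Z" by (simp add: coords_def vector_matrix_mul_assoc WZ)
    then show ?thesis by (simp add: vector_matrix_mult_def mult.commute)
  qed

  define rhs where "rhs j i = (\<Sum>p\<in>UNIV. Z $ p $ j * (coords W (d' i) $ p * (1 - exp (\<alpha> p - lam' i))))" for j i
  have rhs_l2: "rhs j \<in> l2" for j
  proof -
    have "(\<lambda>i. coords W (d' i) $ p * (1 - exp (\<alpha> p - lam' i))) \<in> l2" for p
    proof (rule l2_finite_change[OF near_unit_rhs_l2[OF near, of p]])
      show "finite ((UNIV :: 'n set) \<times> {- int N..int N})" by simp
      fix i :: "'n \<times> int" assume "i \<notin> UNIV \<times> {- int N..int N}"
      then have "d' i = dhat' i" using d'_tail[of "snd i" "fst i"] by (cases i) auto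
      then show "coords W (d' i) $ p * (1 - exp (\<alpha> p - lam' i)) = coords W (dhat' i) $ p * (1 - exp (\<alpha> p - lam' i))"
        by simp
    qed
    then show ?thesis unfolding rhs_def[abs_def] by (intro l2_sum l2_scale) auto
  qed
  have "\<exists>a\<in>l2. \<forall>i. pairing (moment_row \<alpha> (coords W (d' i)) (lam' i)) a = rhs j i" for j
    using solv rhs_l2[of j] unfolding solvable_rows_def by blast
  then obtain a where a: "\<And>j. a j \<in> l2"
    "\<And>j i. pairing (moment_row \<alpha> (coords W (d' i)) (lam' i)) (a j) = rhs j i" by metis
  have "\<exists>f :: 'n \<Rightarrow> real \<Rightarrow> complex. (\<forall>q. f q \<in> borel_measurable unit_ivl) \<and>
      (\<forall>q. integrable unit_ivl (\<lambda>\<theta>. (cmod (f q \<theta>))\<^sup>2)) \<and>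
      (\<forall>d s. (\<Sum>q\<in>UNIV. vec_cnj d $ q * (LINT \<theta>|unit_ivl. exp (s * of_real \<theta>) * f q \<theta>))
        = pairing (moment_row \<alpha> (coords W d) s) (a j))" for j
  proof -
    obtain f :: "'n \<Rightarrow> real \<Rightarrow> complex" where "\<And>q. f q \<in> borel_measurable unit_ivl"
      "\<And>q. integrable unit_ivl (\<lambda>\<theta>. (cmod (f q \<theta>))\<^sup>2)"
      "\<And>d s. (\<Sum>q\<in>UNIV. vec_cnj d $ q * (LINT \<theta>|unit_ivl. exp (s * of_real \<theta>) * f q \<theta>))
        = pairing (moment_row \<alpha> (coords W d) s) (a j)"
      by (rule moment_problem[OF a(1)[of j], of \<alpha> W]) (rule that)
    then show ?thesis by (intro exI[of _ f]) simp
  qed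
  from choice[OF allI[OF this]] obtain f :: "'n \<Rightarrow> 'n \<Rightarrow> real \<Rightarrow> complex"
    where "\<forall>j. (\<forall>q. f j q \<in> borel_measurable unit_ivl) \<and>
      (\<forall>q. integrable unit_ivl (\<lambda>\<theta>. (cmod (f j q \<theta>))\<^sup>2)) \<and>
      (\<forall>d s. (\<Sum>q\<in>UNIV. vec_cnj d $ q * (LINT \<theta>|unit_ivl. exp (s * of_real \<theta>) * f j q \<theta>))
        = pairing (moment_row \<alpha> (coords W d) s) (a j))" ..
  then have f: "f j q \<in> borel_measurable unit_ivl" "integrable unit_ivl (\<lambda>\<theta>. (cmod (f j q \<theta>))\<^sup>2)"
    "(\<Sum>q\<in>UNIV. vec_cnj d $ q * (LINT \<theta>|unit_ivl. exp (s * of_real \<theta>) * f j q \<theta>))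
        = pairing (moment_row \<alpha> (coords W d) s) (a j)" for j q d s
    by simp_all
  define A2 where "A2 \<theta> = (\<chi> q j. f j q \<theta>)" for \<theta>
  define A3 :: "real \<Rightarrow> complex^'n^'n" where "A3 = (\<lambda>_. 0)"

  define d where "d m k = d' (m, k)" for m k
  have kernel: "vec_cnj (d m k) v* char_matrix A1 A2 A3 (lam m k) = 0" for m k
  proof (subst vec_eq_iff, intro allI)
    fix j
    let ?w = "lam' (m, k)" and ?y = "coords W (d' (m, k))"
    have "(\<Sum>q\<in>UNIV. vec_cnj (d m k) $ q * (LINT \<theta>|unit_ivl. exp (?w * of_real \<theta>) * A2 \<theta> $ q $ j)) = rhs j (m, k)"
      by (simp add: A2_def f(3) a(2) d_def)
    moreover have "vec_cnj (d m k) $ j - exp (- ?w) * (vec_cnj (d m k) v* A1) $ j = rhs j (m, k)"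
      unfolding A1_row v_row rhs_def sum_distrib_left sum_subtractf[symmetric]
      by (intro sum.cong) (simp_all add: d_def exp_diff exp_\<alpha> exp_minus divide_inverse algebra_simps)
    ultimately have "(vec_cnj (d m k) v* char_matrix A1 A2 A3 ?w) $ j = 0"
      unfolding A3_def left_mult_char_matrix by simp
    then show "(vec_cnj (d m k) v* char_matrix A1 A2 A3 (lam m k)) $ j = 0 $ j" by (simp add: lam'_def)
  qed
  \<comment> \<open>A zero vector would make the corresponding row zero, contrary to solvability.\<close>
  have nonzero: "vec_cnj (d m k) \<noteq> 0" for m k
  proof
    assume "vec_cnj (d m k) = 0"
    then have "coords W (d' (m, k)) = 0" by (simp add: coords_def d_def)
    then have zero: "moment_row \<alpha> (coords W (d' (m, k))) s = (\<lambda>_. 0)" for s by (simp add: moment_row_def fun_eq_iff)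
    obtain b where "\<And>i. pairing (moment_row \<alpha> (coords W (d' i)) (lam' i)) b = unit_seq (m, k) i"
      using solv unit_seq_l2[of "(m, k)"] unfolding solvable_rows_def by blast
    from this[of "(m, k)"] show False by (simp add: zero pairing_def unit_seq_def)
  qed

  have sum_small: "(\<lambda>k. (norm (d m k - dhat m k))\<^sup>2) summable_on UNIV \<and>
         (\<Sum>\<^sub>\<infinity>k. (norm (d m k - dhat m k))\<^sup>2) < \<epsilon>" for m
  proof -
    let ?h = "\<lambda>k. (norm (d m k - dhat m k))\<^sup>2"
    have outside: "?h k = 0" if "k \<notin> symm N" for k
      using d'_tail[of k m] that by (auto simp: symm_def d_def dhat'_def)
    have hs: "(?h has_sum sum ?h (symm N)) UNIV"
      by (rule has_sum_finite_neutralI[of "symm N"]) (use outside in auto)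
    have "sum ?h (symm N) \<le> (\<Sum>k\<in>symm N. \<eta>\<^sup>2)"
    proof (rule sum_mono)
      fix k show "?h k \<le> \<eta>\<^sup>2" using d'_near[of "(m, k)"] by (auto simp: d_def dhat'_def)
    qed
    also have "\<dots> = c * \<eta>\<^sup>2" by (simp add: symm_def c_def)
    also have "\<dots> < \<epsilon>" by (rule \<eta>_small)
    finally show ?thesis using hs by (auto simp: infsumI dest: has_sum_imp_summable)
  qed
  have tail: "\<exists>N::nat. \<forall>m k. \<bar>k\<bar> > int N \<longrightarrow> d m k = dhat m k"
    using d'_tail by (intro exI[of _ N]) (simp add: d_def dhat'_def)
  have "L2_entries A2" unfolding L2_entries_def A2_def using f(1,2) by simp
  moreover have "L2_entries A3" "matrix_integral A3 = 0"
    by (simp_all add: L2_entries_def matrix_integral_def A3_def vec_eq_iff)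
  moreover have "det (char_matrix A1 A2 A3 (lam m k)) = 0" for m k
    by (rule det_zero_if_left_kernel[OF kernel nonzero])
  ultimately have "L2_entries A2 \<and> L2_entries A3 \<and> matrix_integral A3 = 0 \<and>
       (\<forall>m k. det (char_matrix A1 A2 A3 (lam m k)) = 0) \<and>
       (\<forall>m k. vec_cnj (d m k) v* char_matrix A1 A2 A3 (lam m k) = 0)"
    using kernel by simp
  then have matrices: "\<exists>(A1 :: complex^'n^'n) A2 A3.
       L2_entries A2 \<and> L2_entries A3 \<and> matrix_integral A3 = 0 \<and>
       (\<forall>m k. det (char_matrix A1 A2 A3 (lam m k)) = 0) \<and>
       (\<forall>m k. vec_cnj (d m k) v* char_matrix A1 A2 A3 (lam m k) = 0)"
    by (rule exI[of _ A1, OF exI[of _ A2, OF exI[of _ A3]]])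
  show ?thesis by (rule exI[of _ d]) (intro conjI allI sum_small[THEN conjunct1] sum_small[THEN conjunct2] tail matrices)
qed

end
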